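(* For Tree Augmentation with unit costs (i.e. $c_e=1$ for all $e\in E$), the integrality gap of the $3$-Bunch-LP is at most $7/4$. That is, for every feasible unit cost instance $T=(V,F),E$, the minimum size of a set $J\subseteq E$ such that $T\cup J$ is $2$-edge-connected is at most $\frac74$ times the optimal value of the $3$-Bunch-LP.
   Context: Tree Augmentation: the input is a tree $T=(V,F)$ and a set $E\subseteq V\times V$ of additional edges (here with unit costs); the goal is a minimum size $J\subseteq E$ such that $T\cup J$ is $2$-edge-connected. An edge $uv\in E$ covers an edge $f\in F$ if $f$ lies on the unique $uv$-path in $T$. For $B\subseteq F$, $\psi(B)$ is the set of edges in $E$ that cover some $f\in B$. A set $B\subseteq F$ of odd size is a bunch if no $3$ edges in $B$ lie on the same path in $T$; let $w_B=(|B|+1)/2$. The $3$-Bunch-LP is: minimize $\sum_{e\in E}x_e$ subject to $\sum_{e\in\psi(B)}x_e\ge w_B$ for every bunch $B$ with $|B|\le 3$ and $x_e\ge0$ for all $e\in E$. *)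

theory Defs
  imports Complex_Main
begin

text \<open>
  An undirected multigraph consists of a vertex set, a set of edge names and a map sending an edge
  name to its set of endpoints. The trees below are simple graphs, whose edges are two-element
  vertex sets; such a graph is the multigraph with endpoint map \<^term>\<open>id\<close>.
\<close>

definition adj_rel :: "'v set \<Rightarrow> 'e set \<Rightarrow> ('e \<Rightarrow> 'v set) \<Rightarrow> ('v \<times> 'v) set" where
  "adj_rel V A ends = {(x, y). x \<in> V \<and> y \<in> V \<and> (\<exists>e\<in>A. ends e = {x, y})}"

definition graph_connected :: "'v set \<Rightarrow> 'e set \<Rightarrow> ('e \<Rightarrow> 'v set) \<Rightarrow> bool" where
  "graph_connected V A ends \<longleftrightarrow> V \<noteq> {} \<and> (\<forall>u\<in>V. \<forall>v\<in>V. (u, v) \<in> (adj_rel V A ends)\<^sup>*)"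

definition two_edge_connected :: "'v set \<Rightarrow> 'e set \<Rightarrow> ('e \<Rightarrow> 'v set) \<Rightarrow> bool" where
  "two_edge_connected V A ends \<longleftrightarrow>
     graph_connected V A ends \<and> (\<forall>e\<in>A. graph_connected V (A - {e}) ends)"

text \<open>A path is the nonempty list of its pairwise distinct vertices.\<close>

definition path_edges :: "'v list \<Rightarrow> 'v set set" where
  "path_edges p = {{p ! i, p ! Suc i} | i. Suc i < length p}"

definition is_path :: "'v set \<Rightarrow> 'v set set \<Rightarrow> 'v list \<Rightarrow> bool" where
  "is_path V F p \<longleftrightarrow> p \<noteq> [] \<and> distinct p \<and> set p \<subseteq> V \<and> path_edges p \<subseteq> F"

definition has_cycle :: "'v set \<Rightarrow> 'v set set \<Rightarrow> bool" where
  "has_cycle V F \<longleftrightarrow> (\<exists>p. is_path V F p \<and> 3 \<le> length p \<and> {last p, hd p} \<in> F)"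

definition is_tree :: "'v set \<Rightarrow> 'v set set \<Rightarrow> bool" where
  "is_tree V F \<longleftrightarrow> finite V \<and> (\<forall>f\<in>F. f \<subseteq> V \<and> card f = 2) \<and>
     graph_connected V F id \<and> \<not> has_cycle V F"

text \<open>
  A pair \<open>(u, v)\<close> in \<open>E\<close> stands for an undirected edge \<open>uv\<close>. In \<open>T \<union> J\<close> an edge of \<open>J\<close> parallel to
  a tree edge is a second, distinct edge (it covers that tree edge), hence the disjoint sum.
\<close>

definition aug_ends :: "'v set + 'v \<times> 'v \<Rightarrow> 'v set" where
  "aug_ends = case_sum id (\<lambda>(u, v). {u, v})"

definition augmentations :: "'v set \<Rightarrow> 'v set set \<Rightarrow> ('v \<times> 'v) set \<Rightarrow> ('v \<times> 'v) set set" where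
  "augmentations V F E = {J. J \<subseteq> E \<and> two_edge_connected V (F <+> J) aug_ends}"

definition tap_opt :: "'v set \<Rightarrow> 'v set set \<Rightarrow> ('v \<times> 'v) set \<Rightarrow> nat" where
  "tap_opt V F E = Min (card ` augmentations V F E)"

text \<open>In a tree the \<open>uv\<close>-path \<open>p\<close> below exists and is unique.\<close>

definition covers :: "'v set \<Rightarrow> 'v set set \<Rightarrow> 'v \<times> 'v \<Rightarrow> 'v set \<Rightarrow> bool" where
  "covers V F e f \<longleftrightarrow>
     (\<exists>p. is_path V F p \<and> hd p = fst e \<and> last p = snd e \<and> f \<in> path_edges p)"

definition psi :: "'v set \<Rightarrow> 'v set set \<Rightarrow> ('v \<times> 'v) set \<Rightarrow> 'v set set \<Rightarrow> ('v \<times> 'v) set" where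
  "psi V F E B = {e \<in> E. \<exists>f\<in>B. covers V F e f}"

definition bunch :: "'v set \<Rightarrow> 'v set set \<Rightarrow> 'v set set \<Rightarrow> bool" where
  "bunch V F B \<longleftrightarrow> B \<subseteq> F \<and> odd (card B) \<and>
     \<not> (\<exists>p. is_path V F p \<and> 3 \<le> card (B \<inter> path_edges p))"

definition bunch_weight :: "'v set set \<Rightarrow> real" where
  "bunch_weight B = (real (card B) + 1) / 2"

definition bunch3_lp_feasible ::
    "'v set \<Rightarrow> 'v set set \<Rightarrow> ('v \<times> 'v) set \<Rightarrow> ('v \<times> 'v \<Rightarrow> real) \<Rightarrow> bool" where
  "bunch3_lp_feasible V F E x \<longleftrightarrow>
     (\<forall>e\<in>E. 0 \<le> x e) \<and>
     (\<forall>B. bunch V F B \<and> card B \<le> 3 \<longrightarrow> bunch_weight B \<le> (\<Sum>e\<in>psi V F E B. x e))"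

definition bunch3_lp_value :: "'v set \<Rightarrow> 'v set set \<Rightarrow> ('v \<times> 'v) set \<Rightarrow> real" where
  "bunch3_lp_value V F E = Inf {(\<Sum>e\<in>E. x e) | x. bunch3_lp_feasible V F E x}"

end

theory Submission
  imports Defs
begin

text \<open>
  Rooting the tree turns its edges into a laminar family of vertex sets, and a link covers an edge iff
  it crosses the corresponding set. The bunches that matter are \<open>{A, B, C}\<close> with \<open>A\<close>, \<open>B\<close> disjoint
  and contained in \<open>C\<close>.

  Fix a maximal matching \<open>M\<close> of the leaves by links, where twins (two leaves that are the only ones
  inside some set of the family) are not matched. Give every end of a link 3/4 of the weight of the
  link, but an end in an unmatched leaf all of it: since \<open>M\<close> is maximal, only links between
  unmatched twins receive more than 7/4 in total, and these are contracted at the start, which the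
  bunch constraint pays for. Unmatched leaves and contracted sets now hold weight 1, and matched
  pairs hold 3/2.

  Call a set semiclosed if it contains both or none of the leaves of each pair and no link leaves it
  from an unmatched leaf. A minimal semiclosed set is covered by the links of its pairs and, for each
  unmatched leaf, the link that reaches highest. It can be contracted for the weight it holds, with 1
  left over, unless it has exactly three leaves, a pair and an unmatched \<open>a\<close>. In that case the bunch
  constraints single out a member \<open>p\<close> of the pair, linked to \<open>a\<close>, such that after exchanging the
  pair for \<open>{a, p}\<close> every larger semiclosed set with the same leaves can be paid for. Exchanging
  all such pairs simultaneously therefore yields a set that can be contracted.
\<close>

section \<open>Links and laminar families\<close>

text \<open>The constants come from one balance. Let a set contain \<open>u\<close> units
  (contracted sets and unmatched leaves, holding 1 each), \<open>m\<close> pairs of matched leaves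
  and \<open>p\<close> pairs of a second maximal matching, one among the units. Its cover has at
  most u + m - p links. If an ordinary end is paid at rate c, the matched leaves hold at least 2 c
  m, and c = 3/4 is the least rate at which two pairs pay for two links with 1 left over. Then 7/4 =
  1 + c bounds the shares of a link that does not join two unmatched leaves. A pair of units also
  leaves 1 over. What can fall short is m = 1, p = 0: the weight Y at ends outside the units has to
  reach 8/3, so that 3/4 Y is at least 2. As no two units are linked there, Y is at least u + 1,
  which settles u \<ge> 2. The exclusion of twins rules out u = 0, and u = 1 is the obstacle that
  forces the exchange.\<close>

definition crosses :: "'v \<times> 'v \<Rightarrow> 'v set \<Rightarrow> bool" where
  "crosses e S \<longleftrightarrow> (fst e \<in> S) \<noteq> (snd e \<in> S)"

definition joins :: "'v \<times> 'v \<Rightarrow> 'v set \<Rightarrow> 'v set \<Rightarrow> bool" where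
  "joins e X Y \<longleftrightarrow> fst e \<in> X \<and> snd e \<in> Y \<or> fst e \<in> Y \<and> snd e \<in> X"

definition linked :: "('v \<times> 'v) set \<Rightarrow> 'v set \<Rightarrow> 'v set \<Rightarrow> bool" where
  "linked E X Y \<longleftrightarrow> (\<exists>e\<in>E. joins e X Y)"

definition ends :: "'v set \<Rightarrow> 'v \<times> 'v \<Rightarrow> real" where
  "ends S e = of_bool (fst e \<in> S) + of_bool (snd e \<in> S)"

definition laminar :: "'v set set \<Rightarrow> bool" where
  "laminar R \<longleftrightarrow> (\<forall>A\<in>R. \<forall>B\<in>R. A \<subseteq> B \<or> B \<subseteq> A \<or> A \<inter> B = {})"

definition leaves :: "'v set set \<Rightarrow> 'v set set" where
  "leaves R = {X \<in> R. \<forall>Z\<in>R. Z \<subseteq> X \<longrightarrow> Z = X}"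

definition closed_in :: "('v \<times> 'v) set \<Rightarrow> 'v set \<Rightarrow> 'v set \<Rightarrow> bool" where
  "closed_in E X A \<longleftrightarrow> (\<forall>e\<in>E. fst e \<in> X \<or> snd e \<in> X \<longrightarrow> fst e \<in> A \<and> snd e \<in> A)"

text \<open>Stated for an arbitrary graph because it serves several: leaves with twins excluded,
  contracted sets together with free leaves, both combined, and the result of the exchange.\<close>

definition matching :: "'a set \<Rightarrow> ('a \<Rightarrow> 'a \<Rightarrow> bool) \<Rightarrow> 'a set set \<Rightarrow> bool" where
  "matching L rel \<mu> \<longleftrightarrow>
     (\<forall>P\<in>\<mu>. \<exists>X\<in>L. \<exists>Y\<in>L. P = {X, Y} \<and> X \<noteq> Y \<and> rel X Y) \<and>
     (\<forall>P\<in>\<mu>. \<forall>Q\<in>\<mu>. P \<noteq> Q \<longrightarrow> P \<inter> Q = {})"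

definition semiclosed :: "('v \<times> 'v) set \<Rightarrow> 'v set set \<Rightarrow> 'v set set set \<Rightarrow> 'v set \<Rightarrow> bool" where
  "semiclosed E L \<mu> A \<longleftrightarrow>
     (\<forall>P\<in>\<mu>. \<forall>X\<in>P. \<forall>Y\<in>P. X \<subseteq> A \<longrightarrow> Y \<subseteq> A) \<and>
     (\<forall>X\<in>L - \<Union>\<mu>. X \<subseteq> A \<longrightarrow> closed_in E X A)"

lemma joins_commute: "joins e X Y \<longleftrightarrow> joins e Y X"
  by (auto simp: joins_def)

lemma linked_commute: "linked E X Y \<longleftrightarrow> linked E Y X"
  by (simp add: linked_def joins_commute)

lemma semiclosed_pair:
  "semiclosed E L \<mu> A \<Longrightarrow> Q \<in> \<mu> \<Longrightarrow> X \<in> Q \<Longrightarrow> Z \<in> Q \<Longrightarrow> X \<subseteq> A \<Longrightarrow> Z \<subseteq> A"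
  unfolding semiclosed_def by (elim conjE) blast

lemma semiclosed_single:
  "semiclosed E L \<mu> A \<Longrightarrow> X \<in> L \<Longrightarrow> X \<notin> \<Union>\<mu> \<Longrightarrow> X \<subseteq> A \<Longrightarrow> closed_in E X A"
  unfolding semiclosed_def by (elim conjE) blast

lemma semiclosedI:
  assumes "\<And>Q X Z. Q \<in> \<mu> \<Longrightarrow> X \<in> Q \<Longrightarrow> Z \<in> Q \<Longrightarrow> X \<subseteq> A \<Longrightarrow> Z \<subseteq> A"
    and "\<And>X. X \<in> L \<Longrightarrow> X \<notin> \<Union>\<mu> \<Longrightarrow> X \<subseteq> A \<Longrightarrow> closed_in E X A"
  shows "semiclosed E L \<mu> A"
  unfolding semiclosed_def
proof (intro conjI ballI impI)
  show "Z \<subseteq> A" if "Q \<in> \<mu>" "X \<in> Q" "Z \<in> Q" "X \<subseteq> A" for Q X Z by (rule assms(1)[OF that])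
  show "closed_in E X A" if "X \<in> L - \<Union>\<mu>" "X \<subseteq> A" for X using assms(2)[of X] that by simp
qed

lemma laminarD: "laminar R \<Longrightarrow> A \<in> R \<Longrightarrow> B \<in> R \<Longrightarrow> A \<subseteq> B \<or> B \<subseteq> A \<or> A \<inter> B = {}"
  unfolding laminar_def by blast

lemma leaf_below_or_disjoint:
  assumes "laminar R" "X \<in> leaves R" "Z \<in> R"
  shows "X \<subseteq> Z \<or> X \<inter> Z = {}"
  using laminarD[OF assms(1) _ assms(3), of X] assms(2,3) unfolding leaves_def by blast

lemma leaves_disjoint:
  assumes "laminar R" "X \<in> leaves R" "Y \<in> leaves R" "X \<noteq> Y"
  shows "X \<inter> Y = {}"
  using laminarD[OF assms(1), of X Y] assms(2-4) unfolding leaves_def by blast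

lemma ex_minimal_subset:
  assumes "finite R" "A \<in> R"
  obtains X where "X \<in> R" "X \<subseteq> A" "\<And>Z. Z \<in> R \<Longrightarrow> Z \<subseteq> X \<Longrightarrow> Z = X"
proof -
  obtain X where "X \<in> {Z\<in>R. Z \<subseteq> A}" "\<forall>b\<in>{Z\<in>R. Z \<subseteq> A}. b \<subseteq> X \<longrightarrow> X = b"
    using finite_has_minimal2[of "{Z\<in>R. Z \<subseteq> A}" A] assms by auto
  then show ?thesis using that[of X] by blast
qed

lemma ex_leaf_below:
  assumes "finite R" "A \<in> R"
  obtains X where "X \<in> leaves R" "X \<subseteq> A"
proof -
  obtain X where "X \<in> R" "X \<subseteq> A" "\<And>Z. Z \<in> R \<Longrightarrow> Z \<subseteq> X \<Longrightarrow> Z = X"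
    using ex_minimal_subset[OF assms] by metis
  then show ?thesis using that[of X] unfolding leaves_def by simp
qed

section \<open>Matchings\<close>

lemma matchingE:
  assumes "matching L rel \<mu>" "P \<in> \<mu>"
  obtains X Y where "X \<in> L" "Y \<in> L" "P = {X, Y}" "X \<noteq> Y" "rel X Y"
proof -
  have "\<exists>X\<in>L. \<exists>Y\<in>L. P = {X, Y} \<and> X \<noteq> Y \<and> rel X Y"
    using assms unfolding matching_def by simp
  then show ?thesis using that by auto
qed

lemma matching_disjoint:
  "matching L rel \<mu> \<Longrightarrow> P \<in> \<mu> \<Longrightarrow> Q \<in> \<mu> \<Longrightarrow> P \<noteq> Q \<Longrightarrow> P \<inter> Q = {}"
  by (simp add: matching_def)

lemma matching_subset: "matching L rel \<mu> \<Longrightarrow> \<mu> \<subseteq> Pow L"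
  by (auto elim: matchingE)

lemma matching_finite: "finite L \<Longrightarrow> matching L rel \<mu> \<Longrightarrow> finite \<mu>"
  using matching_subset finite_subset by (metis finite_Pow_iff)

lemma matching_card_Union:
  assumes "finite L" "matching L rel \<mu>" "\<nu> \<subseteq> \<mu>"
  shows "card (\<Union>\<nu>) = 2 * card \<nu>"
proof -
  have c: "card P = 2" if "P \<in> \<nu>" for P
    using matchingE[OF assms(2), of P] that assms(3) by (metis card_2_iff subsetD)
  have "card (\<Union>\<nu>) = (\<Sum>P\<in>\<nu>. card P)"
  proof (rule card_Union_disjoint)
    show "pairwise disjnt \<nu>"
    proof (rule pairwiseI)
      fix P Q assume "P \<in> \<nu>" "Q \<in> \<nu>" "P \<noteq> Q"
      then show "disjnt P Q" using matching_disjoint[OF assms(2), of P Q] assms(3) by (auto simp: disjnt_def)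
    qed
    show "finite P" if "P \<in> \<nu>" for P using c[OF that] card.infinite by fastforce
  qed
  then show ?thesis using c by simp
qed

lemma ex_maximal_matching:
  assumes "finite L" "\<And>X Y. rel X Y \<Longrightarrow> rel Y X"
  obtains \<mu> where "matching L rel \<mu>"
    "\<And>X Y. X \<in> L - \<Union>\<mu> \<Longrightarrow> Y \<in> L - \<Union>\<mu> \<Longrightarrow> X \<noteq> Y \<Longrightarrow> \<not> rel X Y"
proof -
  have fin: "finite {\<mu>. matching L rel \<mu>}"
    by (rule finite_subset[of _ "Pow (Pow L)"]) (use assms(1) matching_subset[of L rel] in auto)
  have "matching L rel {}" by (simp add: matching_def)
  then obtain \<mu> where m: "matching L rel \<mu>"
    and mx: "\<And>\<nu>. matching L rel \<nu> \<Longrightarrow> \<mu> \<subseteq> \<nu> \<Longrightarrow> \<mu> = \<nu>"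
    using finite_has_maximal2[OF fin, of "{}"] by auto
  show ?thesis
  proof (rule that[OF m])
    fix X Y assume XY: "X \<in> L - \<Union>\<mu>" "Y \<in> L - \<Union>\<mu>" "X \<noteq> Y"
    show "\<not> rel X Y"
    proof
      assume "rel X Y"
      have "matching L rel (insert {X, Y} \<mu>)"
        unfolding matching_def
      proof (intro conjI ballI impI)
        fix P assume "P \<in> insert {X, Y} \<mu>"
        then show "\<exists>X\<in>L. \<exists>Y\<in>L. P = {X, Y} \<and> X \<noteq> Y \<and> rel X Y"
          using \<open>rel X Y\<close> XY m unfolding matching_def by auto
      next
        fix P Q assume "P \<in> insert {X, Y} \<mu>" "Q \<in> insert {X, Y} \<mu>" "P \<noteq> Q"
        then show "P \<inter> Q = {}"
          using XY matching_disjoint[OF m, of P Q] by auto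
      qed
      then have "{X, Y} \<in> \<mu>" using mx by blast
      then show False using XY by blast
    qed
  qed
qed

text \<open>A link that crosses \<open>X\<close> has exactly one end in \<open>X\<close>, and
  disjoint sets share no ends.\<close>

lemma sum_crosses_le_ends:
  assumes "finite \<X>" "\<And>X Y. X \<in> \<X> \<Longrightarrow> Y \<in> \<X> \<Longrightarrow> X \<noteq> Y \<Longrightarrow> X \<inter> Y = {}"
  shows "(\<Sum>X\<in>\<X>. of_bool (crosses e X)) \<le> ends (\<Union>\<X>) e"
  using assms
proof (induction rule: finite_induct)
  case empty
  then show ?case by (simp add: ends_def)
next
  case (insert X \<F>)
  have dis: "X \<inter> \<Union>\<F> = {}" using insert by blast
  have "ends (\<Union>(insert X \<F>)) e = ends X e + ends (\<Union>\<F>) e"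
    using dis by (auto simp: ends_def of_bool_def)
  moreover have "of_bool (crosses e X) \<le> ends X e"
    by (auto simp: ends_def crosses_def)
  moreover have "(\<Sum>X\<in>\<F>. of_bool (crosses e X)) \<le> ends (\<Union>\<F>) e"
    using insert by blast
  ultimately show ?case unfolding sum.insert[OF insert(1,2)] by linarith
qed

text \<open>
  The sets above a leaf form a chain and a link at the leaf crosses an initial segment of it, so a
  link crossing as many of them as possible crosses every set that some link at the leaf crosses.
\<close>

lemma ex_up_link:
  assumes "finite R" "finite E" "laminar R" "X \<in> leaves R" "X \<noteq> {}" "\<exists>e\<in>E. crosses e X"
  obtains e where "e \<in> E"
    "\<And>Z e'. Z \<in> R \<Longrightarrow> X \<subseteq> Z \<Longrightarrow> e' \<in> E \<Longrightarrow> fst e' \<in> X \<or> snd e' \<in> X \<Longrightarrow> crosses e' Z \<Longrightarrow> crosses e Z"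
proof -
  define G where "G = {e\<in>E. fst e \<in> X \<or> snd e \<in> X}"
  define c where "c e = card {Z\<in>R. X \<subseteq> Z \<and> crosses e Z}" for e
  have "finite G" using assms(2) unfolding G_def by simp
  moreover have "G \<noteq> {}" using assms(6) unfolding G_def crosses_def by blast
  ultimately obtain e where e: "e \<in> G" "\<And>e'. e' \<in> G \<Longrightarrow> c e' \<le> c e"
    using Max_in[of "c ` G"] Max_ge[of "c ` G"] by (metis (no_types, lifting) finite_imageI imageE image_eqI image_is_empty)
  have chain: "Z \<subseteq> Z' \<or> Z' \<subseteq> Z" if "Z \<in> R" "Z' \<in> R" "X \<subseteq> Z" "X \<subseteq> Z'" for Z Z'
    using laminarD[OF assms(3) that(1,2)] that(3,4) assms(5) by blast
  have init: "crosses g Z'" if "g \<in> G" "X \<subseteq> Z'" "Z' \<subseteq> Z" "crosses g Z" for g Z Z'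
    using that unfolding G_def crosses_def by blast
  show ?thesis
  proof (rule that[of e])
    show "e \<in> E" using e unfolding G_def by simp
    fix Z e' assume Z: "Z \<in> R" "X \<subseteq> Z" and e': "e' \<in> E" "fst e' \<in> X \<or> snd e' \<in> X" "crosses e' Z"
    have e'G: "e' \<in> G" using e' unfolding G_def by simp
    show "crosses e Z"
    proof (rule ccontr)
      assume n: "\<not> crosses e Z"
      have "{Z\<in>R. X \<subseteq> Z \<and> crosses e Z} \<subset> {Z\<in>R. X \<subseteq> Z \<and> crosses e' Z}"
      proof
        show "{Z\<in>R. X \<subseteq> Z \<and> crosses e Z} \<subseteq> {Z\<in>R. X \<subseteq> Z \<and> crosses e' Z}"
        proof clarify
          fix Z' assume Z': "Z' \<in> R" "X \<subseteq> Z'" "crosses e Z'"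
          have "Z' \<subseteq> Z"
            using chain[OF Z(1) Z'(1) Z(2) Z'(2)] init[OF e(1) Z(2) _ Z'(3)] n by blast
          then show "crosses e' Z'" using init[OF e'G Z'(2) _ e'(3)] by blast
        qed
        show "{Z\<in>R. X \<subseteq> Z \<and> crosses e Z} \<noteq> {Z\<in>R. X \<subseteq> Z \<and> crosses e' Z}"
          using Z e'(3) n by blast
      qed
      then have "c e < c e'" unfolding c_def by (intro psubset_card_mono) (use assms(1) in auto)
      then show False using e(2)[OF e'G] by simp
    qed
  qed
qed

text \<open>A set \<open>Z\<close> strictly inside \<open>A\<close> fails to be semiclosed in one of
  two ways: it splits a pair, whose link then crosses it, or a link leaves it from an unmatched
  leaf, and then the highest link of that leaf crosses it. Since \<open>A\<close> is semiclosed, the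
  split pair lies inside \<open>A\<close>. Two matched leaves share one link, which gives the count.
  \<open>A\<close> may be any set, so that \<open>UNIV\<close> qualifies.\<close>

lemma minimal_semiclosed_cover:
  assumes "finite R" "finite E" "laminar R" "{} \<notin> R"
    and cut: "\<And>Z. Z \<in> R \<Longrightarrow> \<exists>e\<in>E. crosses e Z"
    and m: "matching (leaves R) (linked E) \<mu>"
    and A: "semiclosed E (leaves R) \<mu> A"
    and min: "\<And>Z. Z \<in> R \<Longrightarrow> Z \<subset> A \<Longrightarrow> \<not> semiclosed E (leaves R) \<mu> Z"
  obtains J where "J \<subseteq> E" "\<And>Z. Z \<in> R \<Longrightarrow> Z \<subset> A \<Longrightarrow> \<exists>e\<in>J. crosses e Z"
    "card J + card {P\<in>\<mu>. P \<subseteq> Pow A} \<le> card {X\<in>leaves R. X \<subseteq> A}"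
proof -
  let ?L = "leaves R"
  define \<mu>A where "\<mu>A = {P\<in>\<mu>. P \<subseteq> Pow A}"
  define UA where "UA = {X\<in>?L - \<Union>\<mu>. X \<subseteq> A}"
  have LR: "?L \<subseteq> R" unfolding leaves_def by blast
  then have finL: "finite ?L" using assms(1) finite_subset by blast
  have "\<forall>P\<in>\<mu>. \<exists>e\<in>E. \<forall>X\<in>P. \<forall>Y\<in>P. X \<noteq> Y \<longrightarrow> joins e X Y"
  proof
    fix P assume "P \<in> \<mu>"
    from matchingE[OF m this] obtain X Y where "P = {X, Y}" "linked E X Y" by metis
    then show "\<exists>e\<in>E. \<forall>X\<in>P. \<forall>Y\<in>P. X \<noteq> Y \<longrightarrow> joins e X Y"
      unfolding linked_def using joins_commute by blast
  qed
  then obtain lk where lk: "\<And>P. P \<in> \<mu> \<Longrightarrow> lk P \<in> E"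
    "\<And>P X Y. P \<in> \<mu> \<Longrightarrow> X \<in> P \<Longrightarrow> Y \<in> P \<Longrightarrow> X \<noteq> Y \<Longrightarrow> joins (lk P) X Y"
    by metis
  have "\<forall>X\<in>?L. \<exists>e\<in>E. \<forall>Z\<in>R. \<forall>e'\<in>E. X \<subseteq> Z \<and> (fst e' \<in> X \<or> snd e' \<in> X) \<and> crosses e' Z \<longrightarrow> crosses e Z"
  proof
    fix X assume X: "X \<in> ?L"
    then have "X \<noteq> {}" "\<exists>e\<in>E. crosses e X" using LR assms(4) cut by auto
    from ex_up_link[OF assms(1-3) X this]
    show "\<exists>e\<in>E. \<forall>Z\<in>R. \<forall>e'\<in>E. X \<subseteq> Z \<and> (fst e' \<in> X \<or> snd e' \<in> X) \<and> crosses e' Z \<longrightarrow> crosses e Z"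
      by metis
  qed
  then obtain up where up: "\<And>X. X \<in> ?L \<Longrightarrow> up X \<in> E"
    "\<And>X Z e'. X \<in> ?L \<Longrightarrow> Z \<in> R \<Longrightarrow> e' \<in> E \<Longrightarrow> X \<subseteq> Z \<Longrightarrow> fst e' \<in> X \<or> snd e' \<in> X \<Longrightarrow> crosses e' Z
       \<Longrightarrow> crosses (up X) Z"
    by metis
  define J where "J = lk ` \<mu>A \<union> up ` UA"
  have fin: "finite \<mu>A" "finite UA"
    using matching_finite[OF finL m] finL unfolding \<mu>A_def UA_def by auto
  have split: "{X\<in>?L. X \<subseteq> A} = \<Union>\<mu>A \<union> UA"
  proof
    show "{X\<in>?L. X \<subseteq> A} \<subseteq> \<Union>\<mu>A \<union> UA"
    proof clarify
      fix X assume X: "X \<in> ?L" "X \<subseteq> A" "X \<notin> UA"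
      then obtain P where P: "P \<in> \<mu>" "X \<in> P" unfolding UA_def by auto
      then have "\<forall>Y\<in>P. Y \<subseteq> A" using A X(2) unfolding semiclosed_def by blast
      then show "X \<in> \<Union>\<mu>A" using P unfolding \<mu>A_def by auto
    qed
    show "\<Union>\<mu>A \<union> UA \<subseteq> {X\<in>?L. X \<subseteq> A}"
      using matching_subset[OF m] unfolding \<mu>A_def UA_def by auto
  qed
  have "\<Union>\<mu>A \<inter> UA = {}" unfolding \<mu>A_def UA_def by auto
  moreover have "finite (\<Union>\<mu>A)" using split finL by (metis (no_types, lifting) finite_Un finite_subset mem_Collect_eq subsetI)
  moreover have "card (\<Union>\<mu>A) = 2 * card \<mu>A"
    using matching_card_Union[OF finL m, of \<mu>A] unfolding \<mu>A_def by blast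
  ultimately have c: "card {X\<in>?L. X \<subseteq> A} = 2 * card \<mu>A + card UA"
    unfolding split using fin card_Un_disjoint by metis
  have "card J \<le> card \<mu>A + card UA"
    unfolding J_def using fin card_Un_le[of "lk ` \<mu>A" "up ` UA"] card_image_le[of \<mu>A lk] card_image_le[of UA up]
    by linarith
  then have cJ: "card J + card {P\<in>\<mu>. P \<subseteq> Pow A} \<le> card {X\<in>?L. X \<subseteq> A}"
    using c unfolding \<mu>A_def by simp
  have "J \<subseteq> E" unfolding J_def using lk(1) up(1) unfolding \<mu>A_def UA_def by auto
  moreover have "\<exists>e\<in>J. crosses e Z" if Z: "Z \<in> R" "Z \<subset> A" for Z
  proof -
    from min[OF Z] consider
      (pair) P X Y where "P \<in> \<mu>" "X \<in> P" "Y \<in> P" "X \<subseteq> Z" "\<not> Y \<subseteq> Z"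
      | (single) X where "X \<in> ?L - \<Union>\<mu>" "X \<subseteq> Z" "\<not> closed_in E X Z"
      unfolding semiclosed_def by blast
    then show ?thesis
    proof cases
      case pair
      have L: "Y \<in> ?L" "X \<in> ?L" using pair(1-3) matching_subset[OF m] by auto
      have "Y \<inter> Z = {}" using leaf_below_or_disjoint[OF assms(3) L(1) Z(1)] pair(5) by blast
      moreover have "joins (lk P) X Y" using lk(2) pair by blast
      ultimately have "crosses (lk P) Z" using pair(4) unfolding joins_def crosses_def by blast
      moreover have "P \<subseteq> Pow A"
      proof -
        have "X \<subseteq> A" using pair(4) Z(2) by auto
        then have "\<forall>Y\<in>P. Y \<subseteq> A" using A pair(1,2) unfolding semiclosed_def by blast
        then show ?thesis by auto
      qed
      ultimately show ?thesis unfolding J_def \<mu>A_def using pair(1) by auto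
    next
      case single
      then obtain e' where e': "e' \<in> E" "fst e' \<in> X \<or> snd e' \<in> X" "\<not> (fst e' \<in> Z \<and> snd e' \<in> Z)"
        unfolding closed_in_def by auto
      then have "crosses e' Z" using single(2) unfolding crosses_def by blast
      then have "crosses (up X) Z" using up(2)[of X Z e'] e' single Z(1) by blast
      moreover have "X \<in> UA" unfolding UA_def using single Z(2) by blast
      ultimately show ?thesis unfolding J_def by blast
    qed
  qed
  ultimately show ?thesis using that cJ by blast
qed

section \<open>The linear program of a laminar family\<close>

text \<open>What is left of the LP once the tree is forgotten: \<open>cut\<close> and
  \<open>bunch\<close> are constraints for one and for three edges, with (3 + 1) / 2 = 2. By
  \<open>crossing\<close>, links whose ends no set separates have been discarded; otherwise a link
  inside a single unmatched leaf could collect 2.\<close>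

locale laminar_lp =
  fixes \<L> :: "'v set set" and E :: "('v \<times> 'v) set" and x :: "'v \<times> 'v \<Rightarrow> real"
  assumes finite_family: "finite \<L>"
    and finite_links: "finite E"
    and laminar: "laminar \<L>"
    and empty_notin: "{} \<notin> \<L>"
    and nonneg: "e \<in> E \<Longrightarrow> 0 \<le> x e"
    and cut: "S \<in> \<L> \<Longrightarrow> 1 \<le> (\<Sum>e\<in>E. x e * of_bool (crosses e S))"
    and bunch: "A \<in> \<L> \<Longrightarrow> B \<in> \<L> \<Longrightarrow> C \<in> \<L> \<Longrightarrow> A \<inter> B = {} \<Longrightarrow> A \<subseteq> C \<Longrightarrow> B \<subseteq> C \<Longrightarrow>
      2 \<le> (\<Sum>e\<in>E. x e * of_bool (crosses e A \<or> crosses e B \<or> crosses e C))"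
    and crossing: "e \<in> E \<Longrightarrow> \<exists>S\<in>\<L>. crosses e S"
begin

text \<open>Weight estimates are proved as inequalities between counts for each single link;
  \<open>tot_mono\<close> then carries them over to the LP solution.\<close>

definition tot :: "('v \<times> 'v \<Rightarrow> real) \<Rightarrow> real" where
  "tot f = (\<Sum>e\<in>E. x e * f e)"

lemma tot_mono: "(\<And>e. e \<in> E \<Longrightarrow> f e \<le> g e) \<Longrightarrow> tot f \<le> tot g"
  unfolding tot_def using nonneg by (intro sum_mono mult_left_mono) auto

lemma tot_nonneg: "(\<And>e. e \<in> E \<Longrightarrow> 0 \<le> f e) \<Longrightarrow> 0 \<le> tot f"
  unfolding tot_def using nonneg by (intro sum_nonneg mult_nonneg_nonneg) auto

lemma tot_add: "tot (\<lambda>e. f e + g e) = tot f + tot g"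
  by (simp add: tot_def distrib_left sum.distrib)

lemma tot_cmult: "tot (\<lambda>e. c * f e) = c * tot f"
  by (simp add: tot_def sum_distrib_left algebra_simps)

lemma tot_sum: "tot (\<lambda>e. \<Sum>i\<in>I. f i e) = (\<Sum>i\<in>I. tot (f i))"
  unfolding tot_def by (simp add: sum_distrib_left) (rule sum.swap)

lemma cut_tot: "S \<in> \<L> \<Longrightarrow> 1 \<le> tot (\<lambda>e. of_bool (crosses e S))"
  using cut by (simp add: tot_def)

lemma bunch_tot: "A \<in> \<L> \<Longrightarrow> B \<in> \<L> \<Longrightarrow> C \<in> \<L> \<Longrightarrow> A \<inter> B = {} \<Longrightarrow> A \<subseteq> C \<Longrightarrow> B \<subseteq> C \<Longrightarrow>
    2 \<le> tot (\<lambda>e. of_bool (crosses e A \<or> crosses e B \<or> crosses e C))"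
  using bunch by (simp add: tot_def)

lemma sum_cuts_le:
  assumes "\<X> \<subseteq> \<L>" "finite \<X>"
  shows "real (card \<X>) \<le> tot (\<lambda>e. \<Sum>X\<in>\<X>. of_bool (crosses e X))"
proof -
  have "real (card \<X>) \<le> (\<Sum>X\<in>\<X>. tot (\<lambda>e. of_bool (crosses e X)))"
    using sum_bounded_below[of \<X> 1 "\<lambda>X. tot (\<lambda>e. of_bool (crosses e X))"] cut_tot assms(1) by auto
  then show ?thesis unfolding tot_sum .
qed

lemma crossed:
  assumes "S \<in> \<L>" shows "\<exists>e\<in>E. crosses e S"
proof (rule ccontr)
  assume "\<not> ?thesis"
  then have "tot (\<lambda>e. of_bool (crosses e S)) = 0" by (simp add: tot_def)
  then show False using cut_tot[OF assms] by simp
qed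

text \<open>
  The deficient case of the contraction argument: a leaf \<open>a\<close> without links leaving \<open>D\<close>, and two
  leaves \<open>b\<close>, \<open>b'\<close> that are matched to each other.
\<close>

lemma ends_closed_leaf:
  assumes "p' \<in> \<L>" "Z \<in> \<L>" "a \<inter> p = {}" "a \<inter> p' = {}" "p \<inter> p' = {}" "a \<subseteq> Z" "p \<subseteq> Z" "p' \<subseteq> Z"
    and "closed_in E a Z" "closed_in E p' Z"
  shows "3 + tot (\<lambda>e. of_bool (joins e a p)) - tot (\<lambda>e. of_bool (joins e a p')) \<le> tot (ends (Z - a))"
proof -
  \<comment> \<open>A link crossing \<open>p'\<close> stays in \<open>Z\<close>, so both its ends
    count on the right unless one is in \<open>a\<close>, which \<open>joins e a p'\<close> makes up
    for. A link crossing \<open>Z\<close> has its inner end outside \<open>a\<close> and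
    \<open>p'\<close>, and a link from \<open>a\<close> to \<open>p\<close> still has its end in
    \<open>p\<close>.\<close>
  have "of_bool (crosses e Z) + of_bool (joins e a p) + 2 * of_bool (crosses e p')
      \<le> ends (Z - a) e + of_bool (joins e a p')" if "e \<in> E" for e
  proof -
    have "(u \<in> a \<longrightarrow> u \<notin> p \<and> u \<notin> p' \<and> u \<in> Z) \<and> (u \<in> p \<longrightarrow> u \<notin> p' \<and> u \<in> Z) \<and> (u \<in> p' \<longrightarrow> u \<in> Z)" for u using assms(3-8) by blast
    note m = this[of "fst e"] this[of "snd e"]
    have "(fst e \<in> a \<or> snd e \<in> a \<longrightarrow> fst e \<in> Z \<and> snd e \<in> Z) \<and> (fst e \<in> p' \<or> snd e \<in> p' \<longrightarrow> fst e \<in> Z \<and> snd e \<in> Z)"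
      using assms that unfolding closed_in_def by blast
    with m show ?thesis
      unfolding crosses_def joins_def ends_def Diff_iff of_bool_def by (smt (verit))
  qed
  from tot_mono[OF this]
  have "tot (\<lambda>e. of_bool (crosses e Z)) + tot (\<lambda>e. of_bool (joins e a p)) + 2 * tot (\<lambda>e. of_bool (crosses e p'))
      \<le> tot (ends (Z - a)) + tot (\<lambda>e. of_bool (joins e a p'))"
    by (simp add: tot_add tot_cmult)
  then show ?thesis using cut_tot[OF assms(1)] cut_tot[OF assms(2)] by linarith
qed

text \<open>Only the three leaf cuts are used. A link crossing \<open>a\<close> has its other end in
  \<open>D - a\<close>; links from \<open>a\<close> to \<open>p\<close> or \<open>p'\<close> cross
  two leaves but have only one end in \<open>D - a\<close>, hence the subtraction.\<close>

lemma ends_ge_star: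
  assumes "a \<in> \<L>" "p \<in> \<L>" "p' \<in> \<L>" "a \<inter> p = {}" "a \<inter> p' = {}" "p \<inter> p' = {}" "a \<subseteq> D" "p \<subseteq> D" "p' \<subseteq> D"
    and "closed_in E a D"
  shows "3 - tot (\<lambda>e. of_bool (joins e a p)) - tot (\<lambda>e. of_bool (joins e a p')) \<le> tot (ends (D - a))"
proof -
  have "of_bool (crosses e a) + of_bool (crosses e p) + of_bool (crosses e p')
      \<le> ends (D - a) e + of_bool (joins e a p) + of_bool (joins e a p')" if "e \<in> E" for e
  proof -
    have "(u \<in> a \<longrightarrow> u \<notin> p \<and> u \<notin> p' \<and> u \<in> D) \<and> (u \<in> p \<longrightarrow> u \<notin> p' \<and> u \<in> D) \<and> (u \<in> p' \<longrightarrow> u \<in> D)" for u using assms(4-9) by blast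
    note m = this[of "fst e"] this[of "snd e"]
    have "fst e \<in> a \<or> snd e \<in> a \<longrightarrow> fst e \<in> D \<and> snd e \<in> D"
      using assms that unfolding closed_in_def by blast
    with m show ?thesis
      unfolding crosses_def joins_def ends_def Diff_iff of_bool_def by (smt (verit))
  qed
  from tot_mono[OF this]
  have "tot (\<lambda>e. of_bool (crosses e a)) + tot (\<lambda>e. of_bool (crosses e p)) + tot (\<lambda>e. of_bool (crosses e p'))
      \<le> tot (ends (D - a)) + tot (\<lambda>e. of_bool (joins e a p)) + tot (\<lambda>e. of_bool (joins e a p'))"
    by (simp add: tot_add)
  then show ?thesis using cut_tot[OF assms(1)] cut_tot[OF assms(2)] cut_tot[OF assms(3)] by linarith
qed

text \<open>Here a set \<open>S\<close> separates \<open>p\<close> from \<open>a\<close> and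
  \<open>p'\<close>. The first bound adds the cut of \<open>p\<close> to the bunch constraint of
  \<open>a\<close>, \<open>p'\<close>, \<open>S\<close>; only links from \<open>a\<close> to
  \<open>p\<close> are counted once too often. The second uses the bunch \<open>S\<close>,
  \<open>p\<close>, \<open>D\<close>, which links from \<open>a\<close> to \<open>p'\<close> do not
  cross, so that these come on top.\<close>

lemma ends_ge_twin:
  assumes "a \<in> \<L>" "p \<in> \<L>" "p' \<in> \<L>" "S \<in> \<L>" "D \<in> \<L>" "a \<inter> p' = {}" "a \<subseteq> S" "p' \<subseteq> S" "S \<inter> p = {}"
    "S \<subseteq> D" "p \<subseteq> D" "closed_in E a D"
  shows "3 - tot (\<lambda>e. of_bool (joins e a p)) \<le> tot (ends (D - a))"
    and "2 + tot (\<lambda>e. of_bool (joins e a p')) \<le> tot (ends (D - a))"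
proof -
  have "of_bool (crosses e a \<or> crosses e p' \<or> crosses e S) + of_bool (crosses e p)
      \<le> ends (D - a) e + of_bool (joins e a p)" if "e \<in> E" for e
  proof -
    have "(u \<in> a \<longrightarrow> u \<notin> p' \<and> u \<in> S) \<and> (u \<in> p' \<longrightarrow> u \<in> S) \<and> (u \<in> S \<longrightarrow> u \<notin> p \<and> u \<in> D) \<and> (u \<in> p \<longrightarrow> u \<in> D)" for u using assms(6-11) by blast
    note m = this[of "fst e"] this[of "snd e"]
    have "fst e \<in> a \<or> snd e \<in> a \<longrightarrow> fst e \<in> D \<and> snd e \<in> D"
      using assms that unfolding closed_in_def by blast
    with m show ?thesis
      unfolding crosses_def joins_def ends_def Diff_iff of_bool_def by (smt (verit))
  qed
  from tot_mono[OF this]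
  have "tot (\<lambda>e. of_bool (crosses e a \<or> crosses e p' \<or> crosses e S)) + tot (\<lambda>e. of_bool (crosses e p))
      \<le> tot (ends (D - a)) + tot (\<lambda>e. of_bool (joins e a p))"
    by (simp only: tot_add)
  then show "3 - tot (\<lambda>e. of_bool (joins e a p)) \<le> tot (ends (D - a))"
    using cut_tot[OF assms(2)] bunch_tot[OF assms(1,3,4,6-8)] by linarith
  have "of_bool (crosses e S \<or> crosses e p \<or> crosses e D) + of_bool (joins e a p') \<le> ends (D - a) e"
    if "e \<in> E" for e
  proof -
    have "(u \<in> a \<longrightarrow> u \<notin> p' \<and> u \<in> S) \<and> (u \<in> p' \<longrightarrow> u \<in> S) \<and> (u \<in> S \<longrightarrow> u \<notin> p \<and> u \<in> D) \<and> (u \<in> p \<longrightarrow> u \<in> D)" for u using assms(6-11) by blast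
    note m = this[of "fst e"] this[of "snd e"]
    have "fst e \<in> a \<or> snd e \<in> a \<longrightarrow> fst e \<in> D \<and> snd e \<in> D"
      using assms that unfolding closed_in_def by blast
    with m show ?thesis
      unfolding crosses_def joins_def ends_def Diff_iff of_bool_def by (smt (verit))
  qed
  from tot_mono[OF this]
  have "tot (\<lambda>e. of_bool (crosses e S \<or> crosses e p \<or> crosses e D)) + tot (\<lambda>e. of_bool (joins e a p'))
      \<le> tot (ends (D - a))"
    by (simp only: tot_add)
  then show "2 + tot (\<lambda>e. of_bool (joins e a p')) \<le> tot (ends (D - a))"
    using bunch_tot[OF assms(4,2,5,9-11)] by linarith
qed

lemma linked_if_tot_pos: "0 < tot (\<lambda>e. of_bool (joins e X Y)) \<Longrightarrow> linked E X Y"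
  unfolding linked_def tot_def by (metis (mono_tags, lifting) mult_zero_right of_bool_eq(1) order_less_irrefl sum.neutral)

text \<open>If a set contains \<open>a\<close> and just one of \<open>b\<close>, \<open>b'\<close>,
  then \<open>p\<close> is the other one; if there is none, \<open>p\<close> is the one to which
  \<open>a\<close> has more link weight. The third conjunct keeps \<open>p'\<close> inside every set
  that contains the new pair; the last one says that larger sets closed at the abandoned
  \<open>p'\<close> are no longer short of weight.\<close>

lemma ex_switch:
  assumes L: "a \<in> \<L>" "b \<in> \<L>" "b' \<in> \<L>" "D \<in> \<L>"
    and disj: "a \<inter> b = {}" "a \<inter> b' = {}" "b \<inter> b' = {}"
    and sub: "a \<subseteq> D" "b \<subseteq> D" "b' \<subseteq> D"
    and cl: "closed_in E a D"
    and deficient: "tot (ends (D - a)) < 8 / 3"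
  shows "\<exists>p p'. {p, p'} = {b, b'} \<and> linked E a p \<and> (\<forall>S\<in>\<L>. a \<subseteq> S \<longrightarrow> p \<subseteq> S \<longrightarrow> p' \<subseteq> S) \<and>
      (\<forall>Z\<in>\<L>. D \<subseteq> Z \<longrightarrow> closed_in E p' Z \<longrightarrow> 8 / 3 \<le> tot (ends (Z - a)))"
proof -
  let ?t = "\<lambda>p. tot (\<lambda>e. of_bool (joins e a p))"
  have t0: "0 \<le> ?t p" for p by (rule tot_nonneg) simp
  have ne: "a \<noteq> {}" "b \<noteq> {}" "b' \<noteq> {}" using L empty_notin by auto
  have closed_a: "closed_in E a Z" if "D \<subseteq> Z" for Z using cl that unfolding closed_in_def by blast
  \<comment> \<open>By \<open>gap\<close>, the bound 3 + ?t p - ?t p' of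
    \<open>ends_closed_leaf\<close> is at least 8/3.\<close>
  have main: ?thesis
    if pp: "{p, p'} = {b, b'}" and pos: "0 < ?t p" and gap: "?t p' \<le> ?t p + 1 / 3"
      and S: "\<forall>S\<in>\<L>. a \<subseteq> S \<longrightarrow> p \<subseteq> S \<longrightarrow> p' \<subseteq> S" for p p'
  proof (rule exI[of _ p], rule exI[of _ p'], intro conjI ballI impI)
    fix Z assume Z: "Z \<in> \<L>" "D \<subseteq> Z" "closed_in E p' Z"
    have "p' \<in> \<L>" "a \<inter> p = {}" "a \<inter> p' = {}" "p \<inter> p' = {}" "p \<subseteq> D" "p' \<subseteq> D"
      using pp L disj sub by (auto simp: doubleton_eq_iff)
    from ends_closed_leaf[OF this(1) Z(1) this(2-4) _ _ _ closed_a[OF Z(2)] Z(3)] subset_trans[OF this(5) Z(2)] subset_trans[OF this(6) Z(2)]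
      subset_trans[OF sub(1) Z(2)] gap
    show "8 / 3 \<le> tot (ends (Z - a))" by linarith
  qed (use pp S linked_if_tot_pos[OF pos] in auto)
  \<comment> \<open>As the total is below 8/3, the two bounds of \<open>ends_ge_twin\<close> say
    \<open>?t p > 1 / 3\<close> and \<open>?t p' < 2 / 3\<close>.\<close>
  have tw: "?thesis" if pp: "{p, p'} = {b, b'}" and S: "S \<in> \<L>" "a \<subseteq> S" "p' \<subseteq> S" "\<not> p \<subseteq> S" for p p' S
  proof -
    have L': "p \<in> \<L>" "p' \<in> \<L>" "a \<inter> p = {}" "a \<inter> p' = {}" "p \<subseteq> D" "p' \<subseteq> D" "p' \<noteq> {}" "p \<noteq> {}"
      using pp L disj sub ne by (auto simp: doubleton_eq_iff)
    have Sp: "S \<inter> p = {}" using laminarD[OF laminar S(1) L'(1)] S L' ne by blast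
    have SD: "S \<subseteq> D" using laminarD[OF laminar S(1) L(4)] S L' ne(1) sub(1) by blast
    note b = ends_ge_twin[OF L(1) L'(1,2) S(1) L(4) L'(4) S(2,3) Sp SD L'(5) cl]
    have "\<forall>T\<in>\<L>. a \<subseteq> T \<longrightarrow> p \<subseteq> T \<longrightarrow> p' \<subseteq> T"
    proof (intro ballI impI)
      fix T assume T: "T \<in> \<L>" "a \<subseteq> T" "p \<subseteq> T"
      then have "S \<subseteq> T" using laminarD[OF laminar S(1) T(1)] S(2,4) ne(1) by blast
      then show "p' \<subseteq> T" using S(3) by blast
    qed
    moreover have "0 < ?t p" "?t p' \<le> ?t p + 1 / 3" using b deficient by linarith+
    ultimately show ?thesis by (intro main[OF pp])
  qed
  show ?thesis
  proof (cases "\<exists>S\<in>\<L>. a \<subseteq> S \<and> (b \<subseteq> S) \<noteq> (b' \<subseteq> S)")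
    case True
    then obtain S where S: "S \<in> \<L>" "a \<subseteq> S" "(b \<subseteq> S) \<noteq> (b' \<subseteq> S)" by blast
    then show ?thesis
      using tw[OF refl S(1,2)] tw[OF insert_commute S(1,2)] by blast
  next
    case False
    have "3 - ?t b - ?t b' \<le> tot (ends (D - a))"
      by (rule ends_ge_star[OF L(1-3) disj sub cl])
    then have "1 / 3 < ?t b + ?t b'" using deficient by linarith
    then consider "?t b' \<le> ?t b" "0 < ?t b" | "?t b \<le> ?t b'" "0 < ?t b'" using t0[of b] t0[of b'] by linarith
    then show ?thesis
    proof cases
      case 1
      then have "?t b' \<le> ?t b + 1 / 3" by linarith
      moreover have "\<forall>S\<in>\<L>. a \<subseteq> S \<longrightarrow> b \<subseteq> S \<longrightarrow> b' \<subseteq> S" using False by blast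
      ultimately show ?thesis by (intro main[OF refl 1(2)])
    next
      case 2
      then have "?t b \<le> ?t b' + 1 / 3" by linarith
      moreover have "\<forall>S\<in>\<L>. a \<subseteq> S \<longrightarrow> b' \<subseteq> S \<longrightarrow> b \<subseteq> S" using False by blast
      ultimately show ?thesis by (intro main[OF insert_commute 2(2)])
    qed
  qed
qed

end

section \<open>Sharing the weight of the links\<close>

text \<open>A set with just two leaves, matched to each other, might hold only 3/2, too little for a
  link and the unit that a contracted set must retain. Left unmatched, two linked twins hold the
  required 2, see \<open>stem_W\<close>.\<close>

definition (in laminar_lp) twin :: "'v set \<Rightarrow> 'v set \<Rightarrow> bool" where
  "twin X Y \<longleftrightarrow> (\<exists>S\<in>\<L>. X \<subseteq> S \<and> Y \<subseteq> S \<and> (\<forall>Z\<in>leaves \<L>. Z \<subseteq> S \<longrightarrow> Z = X \<or> Z = Y))"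

locale matched_laminar_lp = laminar_lp \<L> E x for \<L> :: "'v set set" and E x +
  fixes M :: "'v set set set"
  assumes M: "matching (leaves \<L>) (\<lambda>X Y. linked E X Y \<and> \<not> twin X Y) M"
    and M_max: "X \<in> leaves \<L> - \<Union>M \<Longrightarrow> Y \<in> leaves \<L> - \<Union>M \<Longrightarrow> X \<noteq> Y \<Longrightarrow> linked E X Y \<Longrightarrow> twin X Y"
begin

definition Unm :: "'v set set" where
  "Unm = leaves \<L> - \<Union>M"

text \<open>
  The weight of a link is shared between its ends at these rates. The shares of a link add up to at
  most 7/4, unless the link joins two unmatched leaves.
\<close>

definition rate :: "'v \<Rightarrow> real" where
  "rate v = (if v \<in> \<Union>Unm then 1 else 3 / 4)"

definition load :: "'v set \<Rightarrow> 'v \<times> 'v \<Rightarrow> real" where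
  "load C e = (if fst e \<in> C then rate (fst e) else 0) + (if snd e \<in> C then rate (snd e) else 0)"

text \<open>The weight collected in \<open>C\<close>. The cap of 7/4 per link is what makes
  \<open>W_UNIV\<close> hold for all links.\<close>

definition W :: "'v set \<Rightarrow> real" where
  "W C = tot (\<lambda>e. min (7 / 4) (load C e))"

text \<open>By \<open>load_le\<close>, these are the only links on which the cap in \<open>W\<close>
  can take effect.\<close>

definition heavy :: "'v \<times> 'v \<Rightarrow> bool" where
  "heavy e \<longleftrightarrow> fst e \<in> \<Union>Unm \<and> snd e \<in> \<Union>Unm"

lemma leaves_subset: "leaves \<L> \<subseteq> \<L>"
  unfolding leaves_def by blast

lemma Unm_leaf: "X \<in> Unm \<Longrightarrow> X \<in> leaves \<L>"
  unfolding Unm_def by simp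

lemma Unm_family: "X \<in> Unm \<Longrightarrow> X \<in> \<L>"
  using Unm_leaf leaves_subset by blast

lemma M_leaf: "P \<in> M \<Longrightarrow> X \<in> P \<Longrightarrow> X \<in> leaves \<L>"
  using matching_subset[OF M] by auto

text \<open>Some set separates the two ends by \<open>crossing\<close>, so they lie in different
  leaves; linked unmatched leaves are twins because \<open>M\<close> is maximal.\<close>

lemma heavy_twin:
  assumes "e \<in> E" "heavy e"
  obtains X Y where "X \<in> Unm" "Y \<in> Unm" "X \<noteq> Y" "joins e X Y" "linked E X Y" "twin X Y"
proof -
  obtain X Y where XY: "X \<in> Unm" "Y \<in> Unm" "fst e \<in> X" "snd e \<in> Y"
    using assms(2) unfolding heavy_def by auto
  obtain S where S: "S \<in> \<L>" "crosses e S" using crossing[OF assms(1)] by auto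
  have "X \<noteq> Y"
  proof
    assume "X = Y"
    then show False
      using leaf_below_or_disjoint[OF laminar Unm_leaf[OF XY(1)] S(1)] S(2) XY(3,4)
      unfolding crosses_def by blast
  qed
  moreover have "joins e X Y" using XY unfolding joins_def by simp
  moreover from this have "linked E X Y" using assms(1) unfolding linked_def by auto
  ultimately show ?thesis using that XY(1,2) M_max[of X Y] unfolding Unm_def by blast
qed

lemma load_Un: "C \<inter> D = {} \<Longrightarrow> load (C \<union> D) e = load C e + load D e"
  unfolding load_def by auto

lemma load_nonneg: "0 \<le> load C e"
  unfolding load_def rate_def by auto

lemma load_le: "\<not> heavy e \<Longrightarrow> load C e \<le> 7 / 4"
  unfolding load_def rate_def heavy_def by auto

text \<open>The loads add up link by link. The cap could spoil this only for a heavy link with one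
  end in each set.\<close>

lemma W_Un:
  assumes "C \<inter> D = {}" "\<And>e. e \<in> E \<Longrightarrow> heavy e \<Longrightarrow> \<not> joins e C D"
  shows "W C + W D \<le> W (C \<union> D)"
  unfolding W_def tot_add[symmetric]
proof (rule tot_mono)
  fix e assume e: "e \<in> E"
  show "min (7 / 4) (load C e) + min (7 / 4) (load D e) \<le> min (7 / 4) (load (C \<union> D) e)"
  proof (cases "heavy e")
    case False
    have "load (C \<union> D) e \<le> 7 / 4" by (rule load_le[OF False])
    then show ?thesis using load_Un[OF assms(1), of e] by linarith
  next
    case True
    then have "\<not> joins e C D" by (rule assms(2)[OF e])
    then have "load C e = 0 \<or> load D e = 0" using assms(1) unfolding joins_def load_def by auto
    then show ?thesis using load_Un[OF assms(1), of e] by auto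
  qed
qed

lemma W_UNIV: "W UNIV \<le> 7 / 4 * (\<Sum>e\<in>E. x e)"
proof -
  have "W UNIV \<le> tot (\<lambda>e. 7 / 4 * 1)" unfolding W_def by (rule tot_mono) simp
  then show ?thesis unfolding tot_cmult by (simp add: tot_def)
qed

text \<open>The cuts of the unmatched leaves are paid at rate 1, all other ends at 3/4 at least; by
  the last assumption the cap takes nothing away inside \<open>D\<close>.\<close>

lemma W_ge:
  assumes "finite \<X>" "\<X> \<subseteq> Unm" "\<Union>\<X> \<subseteq> D" "Q \<subseteq> D" "Q \<inter> \<Union>\<X> = {}"
    and nh: "\<And>e. e \<in> E \<Longrightarrow> heavy e \<Longrightarrow> \<not> (fst e \<in> D \<and> snd e \<in> D)"
  shows "real (card \<X>) + 3 / 4 * tot (ends Q) \<le> W D"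
proof -
  have dis: "X \<inter> Y = {}" if "X \<in> \<X>" "Y \<in> \<X>" "X \<noteq> Y" for X Y
    using leaves_disjoint[OF laminar, of X Y] Unm_leaf that assms(2) by blast
  have "real (card \<X>) \<le> tot (\<lambda>e. \<Sum>X\<in>\<X>. of_bool (crosses e X))"
    by (rule sum_cuts_le) (use Unm_family assms(1,2) in auto)
  also have "\<dots> \<le> tot (ends (\<Union>\<X>))"
    by (rule tot_mono) (rule sum_crosses_le_ends[OF assms(1) dis])
  finally have "real (card \<X>) + 3 / 4 * tot (ends Q) \<le> tot (\<lambda>e. ends (\<Union>\<X>) e + 3 / 4 * ends Q e)"
    unfolding tot_add tot_cmult by simp
  also have "\<dots> \<le> W D"
    unfolding W_def
  proof (rule tot_mono)
    fix e assume e: "e \<in> E"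
    have r: "of_bool (v \<in> \<Union>\<X>) + 3 / 4 * of_bool (v \<in> Q) \<le> (if v \<in> D then rate v else 0)" for v
      using assms(2-5) unfolding rate_def by (auto simp: of_bool_def)
    have "ends (\<Union>\<X>) e + 3 / 4 * ends Q e \<le> load D e"
      using r[of "fst e"] r[of "snd e"] unfolding ends_def load_def by argo
    moreover have "load D e \<le> 7 / 4"
    proof (cases "heavy e")
      case True
      then show ?thesis using nh[OF e] unfolding load_def rate_def by auto
    qed (rule load_le)
    ultimately show "ends (\<Union>\<X>) e + 3 / 4 * ends Q e \<le> min (7 / 4) (load D e)" by simp
  qed
  finally show ?thesis .
qed

text \<open>As \<open>S\<close> is the least set above both twins, each set of the family strictly
  inside \<open>S\<close> contains exactly one of them. One link between the twins therefore covers
  all of these sets.\<close>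

definition stem_of :: "'v set \<Rightarrow> 'v set \<Rightarrow> 'v set \<Rightarrow> bool" where
  "stem_of S X Y \<longleftrightarrow> S \<in> \<L> \<and> X \<in> Unm \<and> Y \<in> Unm \<and> X \<noteq> Y \<and> linked E X Y \<and> X \<subseteq> S \<and> Y \<subseteq> S \<and>
     (\<forall>Z\<in>leaves \<L>. Z \<subseteq> S \<longrightarrow> Z = X \<or> Z = Y) \<and> (\<forall>T\<in>\<L>. X \<subseteq> T \<longrightarrow> Y \<subseteq> T \<longrightarrow> S \<subseteq> T)"

definition stem :: "'v set \<Rightarrow> bool" where
  "stem S \<longleftrightarrow> (\<exists>X Y. stem_of S X Y)"

lemma heavy_stem:
  assumes "e \<in> E" "heavy e"
  shows "\<exists>S. stem S \<and> fst e \<in> S \<and> snd e \<in> S"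
proof -
  obtain X Y where XY: "X \<in> Unm" "Y \<in> Unm" "X \<noteq> Y" "joins e X Y" "linked E X Y" "twin X Y"
    using heavy_twin[OF assms] by metis
  obtain S0 where S0: "S0 \<in> \<L>" "X \<subseteq> S0" "Y \<subseteq> S0" "\<forall>Z\<in>leaves \<L>. Z \<subseteq> S0 \<longrightarrow> Z = X \<or> Z = Y"
    using XY(6) unfolding twin_def by auto
  have "finite {T\<in>\<L>. X \<subseteq> T \<and> Y \<subseteq> T}" "S0 \<in> {T\<in>\<L>. X \<subseteq> T \<and> Y \<subseteq> T}"
    using finite_family S0 by auto
  then obtain S where S: "S \<in> {T\<in>\<L>. X \<subseteq> T \<and> Y \<subseteq> T}" "S \<subseteq> S0"
    and min: "\<And>T. T \<in> {T\<in>\<L>. X \<subseteq> T \<and> Y \<subseteq> T} \<Longrightarrow> T \<subseteq> S \<Longrightarrow> T = S"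
    by (rule ex_minimal_subset) blast
  have "X \<noteq> {}" using Unm_family[OF XY(1)] empty_notin by blast
  have least: "S \<subseteq> T" if T: "T \<in> \<L>" "X \<subseteq> T" "Y \<subseteq> T" for T
    using laminarD[OF laminar, of S T] S(1) T min[of T] \<open>X \<noteq> {}\<close> by blast
  have "Z = X \<or> Z = Y" if "Z \<in> leaves \<L>" "Z \<subseteq> S" for Z
    using S0(4) S(2) that by blast
  then have "stem_of S X Y" unfolding stem_of_def using S(1) XY least by simp
  then have "stem S" unfolding stem_def by blast
  moreover have "fst e \<in> S \<and> snd e \<in> S" using XY(4) S(1) unfolding joins_def by blast
  ultimately show ?thesis by blast
qed

text \<open>Nested stems have the same two leaves, hence are the same least set.\<close>

lemma stems_disjoint:
  assumes "stem S" "stem S'" "S \<noteq> S'"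
  shows "S \<inter> S' = {}"
proof -
  have nested: "S' \<subseteq> S" if "stem S" "stem S'" "S \<subseteq> S'" for S S'
  proof -
    obtain X Y where 1: "stem_of S X Y" using \<open>stem S\<close> unfolding stem_def by blast
    obtain X' Y' where 2: "stem_of S' X' Y'" using \<open>stem S'\<close> unfolding stem_def by blast
    have "X \<in> leaves \<L>" "Y \<in> leaves \<L>" "X \<subseteq> S'" "Y \<subseteq> S'" "X \<noteq> Y"
      using 1 that(3) Unm_leaf unfolding stem_of_def by auto
    moreover have "Z = X' \<or> Z = Y'" if "Z \<in> leaves \<L>" "Z \<subseteq> S'" for Z
      using 2 that unfolding stem_of_def by simp
    ultimately have "{X, Y} = {X', Y'}" by (metis insert_commute)
    then have "X' \<subseteq> S" "Y' \<subseteq> S" using 1 unfolding stem_of_def by auto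
    moreover have "S \<in> \<L>" using 1 unfolding stem_of_def by simp
    ultimately show ?thesis using 2 unfolding stem_of_def by simp
  qed
  have "S \<in> \<L>" "S' \<in> \<L>" using assms unfolding stem_def stem_of_def by auto
  then show ?thesis using laminarD[OF laminar, of S S'] nested assms by blast
qed

text \<open>At rate 3/4 the bunch constraint of \<open>X\<close>, \<open>Y\<close>, \<open>S\<close>
  gives 3/2; the surcharge of 1/4 on unmatched leaves gives 1/4 for each of the cuts of
  \<open>X\<close> and \<open>Y\<close>. A link between the twins is counted with 5/4 only, so the
  cap does no harm.\<close>

lemma stem_W:
  assumes "stem S" shows "2 \<le> W S"
proof -
  obtain X Y where S: "S \<in> \<L>" "X \<in> Unm" "Y \<in> Unm" "X \<noteq> Y" "X \<subseteq> S" "Y \<subseteq> S"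
    using assms unfolding stem_def stem_of_def by auto
  have dis: "X \<inter> Y = {}" using leaves_disjoint[OF laminar] Unm_leaf S by blast
  have "tot (\<lambda>e. 3 / 4 * of_bool (crosses e X \<or> crosses e Y \<or> crosses e S) +
      (1 / 4 * of_bool (crosses e X) + 1 / 4 * of_bool (crosses e Y))) \<le> W S"
    unfolding W_def
  proof (rule tot_mono)
    fix e :: "'v \<times> 'v"
    have "(u \<in> X \<longrightarrow> u \<notin> Y \<and> rate u = 1 \<and> u \<in> S) \<and> (u \<in> Y \<longrightarrow> rate u = 1 \<and> u \<in> S) \<and> 3 / 4 \<le> rate u" for u
      using S dis unfolding rate_def by auto
    note m = this[of "fst e"] this[of "snd e"]
    then have "3 / 4 * of_bool (crosses e X \<or> crosses e Y \<or> crosses e S) +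
      (1 / 4 * of_bool (crosses e X) + 1 / 4 * of_bool (crosses e Y)) \<le> load S e"
      unfolding crosses_def load_def
      by (cases "fst e \<in> X"; cases "snd e \<in> X"; cases "fst e \<in> Y"; cases "snd e \<in> Y";
          cases "fst e \<in> S"; cases "snd e \<in> S") simp_all
    moreover have "3 / 4 * of_bool (crosses e X \<or> crosses e Y \<or> crosses e S) +
      (1 / 4 * of_bool (crosses e X) + 1 / 4 * of_bool (crosses e Y)) \<le> (7 / 4 :: real)"
      unfolding of_bool_def by auto
    ultimately show "3 / 4 * of_bool (crosses e X \<or> crosses e Y \<or> crosses e S) +
      (1 / 4 * of_bool (crosses e X) + 1 / 4 * of_bool (crosses e Y)) \<le> min (7 / 4) (load S e)"
      by simp
  qed
  moreover have "2 \<le> tot (\<lambda>e. of_bool (crosses e X \<or> crosses e Y \<or> crosses e S))"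
    by (rule bunch_tot) (use S dis Unm_family in auto)
  moreover have "1 \<le> tot (\<lambda>e. of_bool (crosses e X))" "1 \<le> tot (\<lambda>e. of_bool (crosses e Y))"
    using cut_tot Unm_family S by auto
  ultimately show ?thesis unfolding tot_add tot_cmult by linarith
qed

lemma stems_W:
  assumes "finite \<S>" "\<And>S. S \<in> \<S> \<Longrightarrow> stem S"
  shows "2 * real (card \<S>) \<le> W (\<Union>\<S>)"
  using assms
proof (induction rule: finite_induct)
  case empty
  then show ?case unfolding W_def by (simp add: tot_nonneg load_nonneg)
next
  case (insert S \<S>)
  have dis: "S \<inter> S' = {}" if "S' \<in> \<S>" for S'
    using stems_disjoint[of S S'] insert that by auto
  have "W S + W (\<Union>\<S>) \<le> W (S \<union> \<Union>\<S>)"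
  proof (rule W_Un)
    show "S \<inter> \<Union>\<S> = {}" using dis by blast
    fix e assume e: "e \<in> E" "heavy e"
    \<comment> \<open>A heavy link lies inside a single stem, so it cannot join two different
      ones.\<close>
    obtain T where T: "stem T" "fst e \<in> T" "snd e \<in> T" using heavy_stem[OF e] by auto
    have st: "stem S" "\<And>S'. S' \<in> \<S> \<Longrightarrow> stem S'" using insert by auto
    show "\<not> joins e S (\<Union>\<S>)"
    proof
      assume "joins e S (\<Union>\<S>)"
      then obtain S' where "S' \<in> \<S>" "T \<inter> S \<noteq> {}" "T \<inter> S' \<noteq> {}"
        using T unfolding joins_def by auto
      then have "T = S" "T = S'" using stems_disjoint[of T] T(1) st by auto
      then show False using \<open>S' \<in> \<S>\<close> insert by simp
    qed
  qed
  moreover have "2 \<le> W S" "2 * real (card \<S>) \<le> W (\<Union>\<S>)" using stem_W insert by auto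
  ultimately show ?case using insert by simp
qed

text \<open>
  The members of \<open>\<C>\<close> are contracted. Each of them retains one unit of the weight \<^const>\<open>W\<close> that
  is not yet spent on links.
\<close>

definition state :: "'v set set \<Rightarrow> bool" where
  "state \<C> \<longleftrightarrow> \<C> \<subseteq> \<L> \<and> (\<forall>C\<in>\<C>. \<forall>D\<in>\<C>. C \<noteq> D \<longrightarrow> C \<inter> D = {}) \<and>
    (\<forall>P\<in>M. \<forall>X\<in>P. \<forall>C\<in>\<C>. X \<subseteq> C \<longrightarrow> (\<forall>Y\<in>P. Y \<subseteq> C)) \<and>
    (\<forall>e\<in>E. heavy e \<longrightarrow> (\<exists>C\<in>\<C>. fst e \<in> C \<and> snd e \<in> C)) \<and>
    (\<exists>J\<subseteq>E. (\<forall>C\<in>\<C>. \<forall>S\<in>\<L>. S \<subset> C \<longrightarrow> (\<exists>e\<in>J. crosses e S)) \<and>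
       real (card J) + real (card \<C>) \<le> W (\<Union>\<C>))"

text \<open>The weight 2 of each stem pays for its one link and the retained unit.\<close>

lemma initial_state: "state {S. stem S}"
  unfolding state_def
proof (intro conjI ballI impI)
  have sub: "{S. stem S} \<subseteq> \<L>" unfolding stem_def stem_of_def by auto
  then show "{S. stem S} \<subseteq> \<L>" .
  have fin: "finite {S. stem S}" using sub finite_family finite_subset by blast
  show "C \<inter> D = {}" if "C \<in> {S. stem S}" "D \<in> {S. stem S}" "C \<noteq> D" for C D
    using stems_disjoint that by auto
  \<comment> \<open>Vacuous: the leaves inside a stem are unmatched.\<close>
  show "Y \<subseteq> C" if P: "P \<in> M" "X \<in> P" "C \<in> {S. stem S}" "X \<subseteq> C" "Y \<in> P" for P X Y C
  proof -
    obtain A B where "stem_of C A B" using P(3) unfolding stem_def by auto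
    then have "X \<in> Unm" using M_leaf[OF P(1,2)] P(4) unfolding stem_of_def by auto
    then show ?thesis using P(1,2) unfolding Unm_def by auto
  qed
  show "\<exists>C\<in>{S. stem S}. fst e \<in> C \<and> snd e \<in> C" if "e \<in> E" "heavy e" for e
    using heavy_stem[OF that] by auto
  have "\<forall>S\<in>{S. stem S}. \<exists>e\<in>E. \<forall>T\<in>\<L>. T \<subset> S \<longrightarrow> crosses e T"
  proof
    fix S assume "S \<in> {S. stem S}"
    then obtain X Y where "stem_of S X Y" unfolding stem_def by auto
    then have S: "X \<in> Unm" "Y \<in> Unm" "linked E X Y"
      "\<And>Z. Z \<in> leaves \<L> \<Longrightarrow> Z \<subseteq> S \<Longrightarrow> Z = X \<or> Z = Y"
      "\<And>T. T \<in> \<L> \<Longrightarrow> X \<subseteq> T \<Longrightarrow> Y \<subseteq> T \<Longrightarrow> S \<subseteq> T"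
      unfolding stem_of_def by simp_all
    obtain e where e: "e \<in> E" "joins e X Y" using S(3) unfolding linked_def by auto
    have "crosses e T" if T: "T \<in> \<L>" "T \<subset> S" for T
    proof -
      obtain Z where Z: "Z \<in> leaves \<L>" "Z \<subseteq> T" using ex_leaf_below[OF finite_family T(1)] by metis
      have XT: "X \<subseteq> T \<or> X \<inter> T = {}" "Y \<subseteq> T \<or> Y \<inter> T = {}"
        using leaf_below_or_disjoint[OF laminar _ T(1)] Unm_leaf S(1,2) by auto
      have "Z = X \<or> Z = Y" using S(4)[OF Z(1)] Z(2) T(2) by auto
      moreover have "\<not> (X \<subseteq> T \<and> Y \<subseteq> T)" using S(5)[OF T(1)] T(2) by auto
      ultimately have "X \<subseteq> T \<and> Y \<inter> T = {} \<or> Y \<subseteq> T \<and> X \<inter> T = {}" using XT Z(2) by auto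
      then show ?thesis using e(2) unfolding joins_def crosses_def by blast
    qed
    then show "\<exists>e\<in>E. \<forall>T\<in>\<L>. T \<subset> S \<longrightarrow> crosses e T" using e(1) by auto
  qed
  then obtain lk where lk: "\<And>S. stem S \<Longrightarrow> lk S \<in> E"
    "\<And>S T. stem S \<Longrightarrow> T \<in> \<L> \<Longrightarrow> T \<subset> S \<Longrightarrow> crosses (lk S) T"
    by (metis mem_Collect_eq)
  show "\<exists>J\<subseteq>E. (\<forall>C\<in>{S. stem S}. \<forall>S\<in>\<L>. S \<subset> C \<longrightarrow> (\<exists>e\<in>J. crosses e S)) \<and>
       real (card J) + real (card {S. stem S}) \<le> W (\<Union>{S. stem S})"
  proof (intro exI[of _ "lk ` {S. stem S}"] conjI)
    show "lk ` {S. stem S} \<subseteq> E" using lk(1) by auto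
    show "\<forall>C\<in>{S. stem S}. \<forall>S\<in>\<L>. S \<subset> C \<longrightarrow> (\<exists>e\<in>lk ` {S. stem S}. crosses e S)"
      using lk(2) by auto
    have "card (lk ` {S. stem S}) \<le> card {S. stem S}" by (rule card_image_le[OF fin])
    then show "real (card (lk ` {S. stem S})) + real (card {S. stem S}) \<le> W (\<Union>{S. stem S})"
      using stems_W[OF fin] by fastforce
  qed
qed

end

section \<open>Contracting a semiclosed set\<close>

definition (in matched_laminar_lp) free :: "'v set set \<Rightarrow> 'v set set" where
  "free \<C> = {X \<in> Unm. \<forall>C\<in>\<C>. X \<inter> C = {}}"

text \<open>Contracted sets and free leaves are the units, each worth 1. Matching them to each other
  by a maximal \<open>P\<close> pays off at once: two units pay for the link between them and leave
  1. Where no pair of \<open>P\<close> is present, maximality forbids links between the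
  units.\<close>

locale contracted = matched_laminar_lp \<L> E x M for \<L> :: "'v set set" and E x M +
  fixes \<C> :: "'v set set" and P :: "'v set set set"
  assumes state: "state \<C>"
    and P: "matching (\<C> \<union> free \<C>) (linked E) P"
    and P_max: "X \<in> \<C> \<union> free \<C> - \<Union>P \<Longrightarrow> Y \<in> \<C> \<union> free \<C> - \<Union>P \<Longrightarrow> X \<noteq> Y \<Longrightarrow> \<not> linked E X Y"
begin

text \<open>The family after contraction. Sets strictly inside a contracted set are already covered;
  the contracted set itself stays and becomes a leaf.\<close>

definition "R = {S \<in> \<L>. \<forall>C\<in>\<C>. \<not> S \<subset> C}"
definition "U = \<C> \<union> free \<C>"
definition "Mc = {Q \<in> M. \<forall>X\<in>Q. \<forall>C\<in>\<C>. X \<inter> C = {}}"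
definition "N = Mc \<union> P"
text \<open>The LP weight at ends in \<open>A\<close> outside the units, before scaling;
  \<open>W\<close> pays at least 3/4 of it.\<close>

definition "Y A = tot (ends (A - \<Union>U))"

lemma state_parts:
  "\<C> \<subseteq> \<L>"
  "\<forall>C\<in>\<C>. \<forall>D\<in>\<C>. C \<noteq> D \<longrightarrow> C \<inter> D = {}"
  "\<forall>Q\<in>M. \<forall>X\<in>Q. \<forall>C\<in>\<C>. X \<subseteq> C \<longrightarrow> (\<forall>Z\<in>Q. Z \<subseteq> C)"
  "\<forall>e\<in>E. heavy e \<longrightarrow> (\<exists>C\<in>\<C>. fst e \<in> C \<and> snd e \<in> C)"
  "\<exists>J\<subseteq>E. (\<forall>C\<in>\<C>. \<forall>S\<in>\<L>. S \<subset> C \<longrightarrow> (\<exists>e\<in>J. crosses e S)) \<and>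
     real (card J) + real (card \<C>) \<le> W (\<Union>\<C>)"
  using state unfolding state_def by - (elim conjE, assumption)+

lemma C_family: "C \<in> \<C> \<Longrightarrow> C \<in> \<L>"
  using state_parts(1) by blast

lemma C_disjoint: "C \<in> \<C> \<Longrightarrow> D \<in> \<C> \<Longrightarrow> C \<noteq> D \<Longrightarrow> C \<inter> D = {}"
  using state_parts(2) by blast

lemma C_compatible: "Q \<in> M \<Longrightarrow> X \<in> Q \<Longrightarrow> C \<in> \<C> \<Longrightarrow> X \<subseteq> C \<Longrightarrow> Z \<in> Q \<Longrightarrow> Z \<subseteq> C"
  using state_parts(3) by blast

lemma C_heavy: "e \<in> E \<Longrightarrow> heavy e \<Longrightarrow> \<exists>C\<in>\<C>. fst e \<in> C \<and> snd e \<in> C"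
  using state_parts(4) by blast

lemma family_nonempty: "X \<in> \<L> \<Longrightarrow> X \<noteq> {}"
  using empty_notin by blast

lemma R_family: "A \<in> R \<Longrightarrow> A \<in> \<L>"
  unfolding R_def by simp

lemma finite_R: "finite R"
  unfolding R_def using finite_family by simp

lemma laminar_R: "laminar R"
  using laminar unfolding laminar_def R_def by simp

lemma C_below_or_disjoint:
  assumes "A \<in> R" "C \<in> \<C>" shows "C \<subseteq> A \<or> C \<inter> A = {}"
  using laminarD[OF laminar R_family[OF assms(1)] C_family[OF assms(2)]] assms unfolding R_def by blast

lemma leaf_C:
  assumes "X \<in> leaves \<L>" "C \<in> \<C>" shows "X \<subseteq> C \<or> X \<inter> C = {}"
  by (rule leaf_below_or_disjoint[OF laminar assms(1) C_family[OF assms(2)]])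

lemma C_R:
  assumes "C \<in> \<C>" shows "C \<in> R"
proof -
  have "\<not> C \<subset> D" if "D \<in> \<C>" for D
    using C_disjoint[OF assms that] family_nonempty[OF C_family[OF assms]] by blast
  then show ?thesis unfolding R_def using C_family[OF assms] by simp
qed

lemma leaves_R_iff: "X \<in> leaves R \<longleftrightarrow> X \<in> \<C> \<or> X \<in> leaves \<L> \<and> (\<forall>C\<in>\<C>. X \<inter> C = {})"
proof
  assume X: "X \<in> leaves R"
  then have XR: "X \<in> R" and min: "\<And>Z. Z \<in> R \<Longrightarrow> Z \<subseteq> X \<Longrightarrow> Z = X"
    unfolding leaves_def by auto
  show "X \<in> \<C> \<or> X \<in> leaves \<L> \<and> (\<forall>C\<in>\<C>. X \<inter> C = {})"
  proof (cases "\<exists>C\<in>\<C>. X \<inter> C \<noteq> {}")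
    case True
    then obtain C where C: "C \<in> \<C>" "X \<inter> C \<noteq> {}" by blast
    then have "C \<subseteq> X" using C_below_or_disjoint[OF XR C(1)] by blast
    then show ?thesis using min[OF C_R[OF C(1)]] C(1) by blast
  next
    case False
    have "Z = X" if Z: "Z \<in> \<L>" "Z \<subseteq> X" for Z
    proof (rule min[OF _ Z(2)])
      show "Z \<in> R" unfolding R_def using Z False family_nonempty[OF Z(1)] by blast
    qed
    then show ?thesis using False R_family[OF XR] unfolding leaves_def by blast
  qed
next
  assume "X \<in> \<C> \<or> X \<in> leaves \<L> \<and> (\<forall>C\<in>\<C>. X \<inter> C = {})"
  then show "X \<in> leaves R"
  proof
    assume X: "X \<in> \<C>"
    then have "X \<in> R" by (rule C_R)
    moreover have "Z = X" if "Z \<in> R" "Z \<subseteq> X" for Z using that X unfolding R_def by blast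
    ultimately show ?thesis unfolding leaves_def by blast
  next
    assume X: "X \<in> leaves \<L> \<and> (\<forall>C\<in>\<C>. X \<inter> C = {})"
    then have "X \<in> \<L>" "X \<noteq> {}" using leaves_subset family_nonempty by auto
    then have "X \<in> R" using X unfolding R_def by blast
    moreover have "Z = X" if "Z \<in> R" "Z \<subseteq> X" for Z
      using that X R_family unfolding leaves_def by blast
    ultimately show ?thesis unfolding leaves_def by blast
  qed
qed

text \<open>A contracted set contains both or none of the leaves of a pair in \<open>M\<close>, so a
  matched leaf outside the contracted sets has its partner outside as well.\<close>

lemma leaves_R: "leaves R = U \<union> \<Union>Mc"
proof (intro subset_antisym subsetI)
  fix X assume X: "X \<in> leaves R"
  show "X \<in> U \<union> \<Union>Mc"
  proof (cases "X \<in> U")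
    case False
    then have l: "X \<in> leaves \<L>" "\<And>C. C \<in> \<C> \<Longrightarrow> X \<inter> C = {}" and "X \<notin> Unm"
      using X unfolding leaves_R_iff U_def free_def by auto
    then obtain Q where Q: "Q \<in> M" "X \<in> Q" unfolding Unm_def by auto
    have "Z \<inter> C = {}" if "Z \<in> Q" "C \<in> \<C>" for Z C
    proof (rule ccontr)
      assume "Z \<inter> C \<noteq> {}"
      then have "Z \<subseteq> C" using leaf_C[OF M_leaf[OF Q(1) that(1)] that(2)] by blast
      then have "X \<subseteq> C" using C_compatible[OF Q(1) that(1,2) _ Q(2)] by blast
      then show False using l(2)[OF that(2)] family_nonempty leaves_subset l(1) by blast
    qed
    then have "Q \<in> Mc" unfolding Mc_def using Q(1) by simp
    then show ?thesis using Q(2) by blast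
  qed simp
next
  fix X assume "X \<in> U \<union> \<Union>Mc"
  then show "X \<in> leaves R"
    unfolding leaves_R_iff U_def free_def Mc_def using Unm_leaf M_leaf by blast
qed

lemma U_Mc_disjoint: "U \<inter> \<Union>Mc = {}"
proof (intro subset_antisym subsetI)
  fix X assume "X \<in> U \<inter> \<Union>Mc"
  then obtain Q where Q: "Q \<in> M" "X \<in> Q" "\<And>C. C \<in> \<C> \<Longrightarrow> X \<inter> C = {}" and X: "X \<in> U"
    unfolding Mc_def by auto
  have "X \<notin> \<C>" using Q(3)[of X] family_nonempty C_family by auto
  then have "X \<in> Unm" using X unfolding U_def free_def by simp
  then show "X \<in> {}" using Q unfolding Unm_def by auto
qed simp

lemma leaves_R_subset: "leaves R \<subseteq> R"
  unfolding leaves_def by blast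

lemma finite_leaves_R: "finite (leaves R)"
  using finite_R leaves_R_subset finite_subset by blast

lemma finite_U: "finite U"
  using finite_leaves_R unfolding leaves_R by simp

lemma leaf_R_family: "X \<in> leaves R \<Longrightarrow> X \<in> \<L>"
  using leaves_R_subset R_family by blast

lemma U_leaf: "X \<in> U \<Longrightarrow> X \<in> leaves R"
  unfolding leaves_R by simp

lemma Mc_leaf: "Q \<in> Mc \<Longrightarrow> X \<in> Q \<Longrightarrow> X \<in> leaves R"
  unfolding leaves_R by auto

lemma P_unit: "Q \<in> P \<Longrightarrow> X \<in> Q \<Longrightarrow> X \<in> U"
  using matching_subset[OF P] unfolding U_def by auto

lemma leaf_R_below_or_disjoint:
  "X \<in> leaves R \<Longrightarrow> A \<in> R \<or> A = UNIV \<Longrightarrow> X \<subseteq> A \<or> X \<inter> A = {}"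
  using leaf_below_or_disjoint[OF laminar_R] by blast

lemma leaves_R_disjoint: "X \<in> leaves R \<Longrightarrow> Z \<in> leaves R \<Longrightarrow> X \<noteq> Z \<Longrightarrow> X \<inter> Z = {}"
  by (rule leaves_disjoint[OF laminar_R])

lemma Mc_matching: "matching (\<Union>Mc) (linked E) Mc"
  unfolding matching_def
proof (intro conjI ballI impI)
  fix Q assume Q: "Q \<in> Mc"
  then have "Q \<in> M" unfolding Mc_def by simp
  then obtain X Z where "Q = {X, Z}" "X \<noteq> Z" "linked E X Z"
    by (rule matchingE[OF M]) blast
  then show "\<exists>X\<in>\<Union>Mc. \<exists>Y\<in>\<Union>Mc. Q = {X, Y} \<and> X \<noteq> Y \<and> linked E X Y" using Q by blast
next
  fix Q Q' assume "Q \<in> Mc" "Q' \<in> Mc" "Q \<noteq> Q'"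
  then show "Q \<inter> Q' = {}" using matching_disjoint[OF M, of Q Q'] unfolding Mc_def by simp
qed

lemma N_disjoint:
  assumes "Q \<in> N" "Q' \<in> N" "Q \<noteq> Q'" shows "Q \<inter> Q' = {}"
proof -
  have mixed: "T \<inter> T' = {}" if "T \<in> Mc" "T' \<in> P" for T T'
    using U_Mc_disjoint P_unit[OF that(2)] that(1) by blast
  from assms(1,2) consider "Q \<in> Mc" "Q' \<in> Mc" | "Q \<in> P" "Q' \<in> P" | "Q \<in> Mc" "Q' \<in> P" | "Q' \<in> Mc" "Q \<in> P"
    unfolding N_def by blast
  then show ?thesis
  proof cases
    case 1
    then show ?thesis by (rule matching_disjoint[OF Mc_matching]) (rule assms(3))
  next
    case 2
    then show ?thesis by (rule matching_disjoint[OF P]) (rule assms(3))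
  next
    case 3
    then show ?thesis by (rule mixed)
  next
    case 4
    then show ?thesis using mixed[of Q' Q] by blast
  qed
qed

lemma N_matching: "matching (leaves R) (linked E) N"
proof -
  have "\<exists>X\<in>leaves R. \<exists>Y\<in>leaves R. Q = {X, Y} \<and> X \<noteq> Y \<and> linked E X Y" if "Q \<in> N" for Q
  proof (cases "Q \<in> Mc")
    case True
    then show ?thesis by (rule matchingE[OF Mc_matching]) (auto simp: leaves_R)
  next
    case False
    then have "Q \<in> P" using that unfolding N_def by simp
    then show ?thesis by (rule matchingE[OF P]) (auto simp: leaves_R U_def)
  qed
  then show ?thesis unfolding matching_def by (intro conjI ballI impI N_disjoint) simp_all
qed

lemma Mc_P_disjoint: "Mc \<inter> P = {}"
proof (intro subset_antisym subsetI)
  fix Q assume Q: "Q \<in> Mc \<inter> P"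
  then obtain X where "X \<in> Q" by (auto elim: matchingE[OF P])
  then show "Q \<in> {}" using Q P_unit U_Mc_disjoint by blast
qed simp

section \<open>Counting leaves and weight below a set\<close>

lemma card_below_pairs:
  assumes "matching L rel \<mu>" "finite L" "\<And>Q X Z. Q \<in> \<mu> \<Longrightarrow> X \<in> Q \<Longrightarrow> Z \<in> Q \<Longrightarrow> X \<subseteq> A \<Longrightarrow> Z \<subseteq> A"
  shows "card {X\<in>\<Union>\<mu>. X \<subseteq> A} = 2 * card {Q\<in>\<mu>. Q \<subseteq> Pow A}"
proof -
  have "{X\<in>\<Union>\<mu>. X \<subseteq> A} = \<Union>{Q\<in>\<mu>. Q \<subseteq> Pow A}" using assms(3) by blast
  then show ?thesis using matching_card_Union[OF assms(2,1), of "{Q\<in>\<mu>. Q \<subseteq> Pow A}"] by simp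
qed

lemma finite_Mc: "finite Mc" and finite_P: "finite P"
  using matching_finite[OF finite_leaves_R N_matching] unfolding N_def by auto

lemma card_N_below: "card {Q\<in>N. Q \<subseteq> Pow A} = card {Q\<in>Mc. Q \<subseteq> Pow A} + card {Q\<in>P. Q \<subseteq> Pow A}"
proof -
  have "{Q\<in>N. Q \<subseteq> Pow A} = {Q\<in>Mc. Q \<subseteq> Pow A} \<union> {Q\<in>P. Q \<subseteq> Pow A}" unfolding N_def by blast
  then show ?thesis using card_Un_disjoint Mc_P_disjoint finite_Mc finite_P
    by (metis (no_types, lifting) disjoint_iff finite_subset mem_Collect_eq subsetI)
qed

lemma card_leaves_below:
  assumes "semiclosed E (leaves R) N A"
  shows "card {X\<in>leaves R. X \<subseteq> A} = card {X\<in>U. X \<subseteq> A} + 2 * card {Q\<in>Mc. Q \<subseteq> Pow A}"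
proof -
  have "{X\<in>leaves R. X \<subseteq> A} = {X\<in>U. X \<subseteq> A} \<union> {X\<in>\<Union>Mc. X \<subseteq> A}" unfolding leaves_R by blast
  moreover have "card {X\<in>\<Union>Mc. X \<subseteq> A} = 2 * card {Q\<in>Mc. Q \<subseteq> Pow A}"
  proof (rule card_below_pairs[OF Mc_matching])
    show "finite (\<Union>Mc)" using finite_leaves_R unfolding leaves_R by simp
    show "Z \<subseteq> A" if "Q \<in> Mc" "X \<in> Q" "Z \<in> Q" "X \<subseteq> A" for Q X Z
      using semiclosed_pair[OF assms _ that(2-4)] that(1) unfolding N_def by simp
  qed
  moreover have "card ({X\<in>U. X \<subseteq> A} \<union> {X\<in>\<Union>Mc. X \<subseteq> A}) = card {X\<in>U. X \<subseteq> A} + card {X\<in>\<Union>Mc. X \<subseteq> A}"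
  proof (rule card_Un_disjoint)
    show "finite {X\<in>U. X \<subseteq> A}" using finite_U by simp
    show "finite {X\<in>\<Union>Mc. X \<subseteq> A}"
      by (rule finite_subset[OF _ finite_leaves_R]) (auto simp: leaves_R)
    show "{X\<in>U. X \<subseteq> A} \<inter> {X\<in>\<Union>Mc. X \<subseteq> A} = {}" using U_Mc_disjoint by blast
  qed
  ultimately show ?thesis by simp
qed

text \<open>Each matched leaf contributes its cut, and all these leaves are disjoint from the
  units.\<close>

lemma Y_ge_pairs: "2 * real (card {Q\<in>Mc. Q \<subseteq> Pow A}) \<le> Y A"
proof -
  define \<X> where "\<X> = \<Union>{Q\<in>Mc. Q \<subseteq> Pow A}"
  have sub: "\<X> \<subseteq> \<Union>Mc" unfolding \<X>_def by blast
  then have leaf: "\<X> \<subseteq> leaves R" unfolding leaves_R by blast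
  have fin: "finite \<X>" using leaf finite_leaves_R finite_subset by blast
  have "card \<X> = 2 * card {Q\<in>Mc. Q \<subseteq> Pow A}"
    unfolding \<X>_def by (rule matching_card_Union[OF _ Mc_matching])
      (use finite_leaves_R in \<open>auto simp: leaves_R\<close>)
  moreover have "real (card \<X>) \<le> tot (\<lambda>e. \<Sum>X\<in>\<X>. of_bool (crosses e X))"
    by (rule sum_cuts_le) (use leaf leaf_R_family fin in auto)
  moreover have "tot (\<lambda>e. \<Sum>X\<in>\<X>. of_bool (crosses e X)) \<le> Y A"
    unfolding Y_def
  proof (rule tot_mono)
    fix e
    have "(\<Sum>X\<in>\<X>. of_bool (crosses e X)) \<le> ends (\<Union>\<X>) e"
      by (rule sum_crosses_le_ends[OF fin]) (use leaves_R_disjoint leaf in blast)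
    moreover have "\<Union>\<X> \<subseteq> A - \<Union>U"
    proof -
      have "X \<inter> Z = {}" if "X \<in> \<X>" "Z \<in> U" for X Z
        using leaves_R_disjoint[of X Z] leaf U_leaf that sub U_Mc_disjoint by blast
      then show ?thesis unfolding \<X>_def by blast
    qed
    then have "ends (\<Union>\<X>) e \<le> ends (A - \<Union>U) e" by (auto simp: ends_def of_bool_def)
    ultimately show "(\<Sum>X\<in>\<X>. of_bool (crosses e X)) \<le> ends (A - \<Union>U) e" by linarith
  qed
  ultimately show ?thesis by linarith
qed

lemma unit_closed:
  assumes "semiclosed E (leaves R) N A" "\<not> (\<exists>Q\<in>P. Q \<subseteq> Pow A)" "X \<in> U" "X \<subseteq> A"
  shows "X \<notin> \<Union>N" "closed_in E X A"
proof -
  show n: "X \<notin> \<Union>N"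
  proof
    assume "X \<in> \<Union>N"
    then obtain Q where Q: "X \<in> Q" "Q \<in> P" using assms(3) U_Mc_disjoint unfolding N_def by blast
    then have "Z \<subseteq> A" if "Z \<in> Q" for Z
      using semiclosed_pair[OF assms(1) _ Q(1) that assms(4)] unfolding N_def by simp
    then show False using assms(2) Q(2) by blast
  qed
  show "closed_in E X A" by (rule semiclosed_single[OF assms(1) U_leaf[OF assms(3)] n assms(4)])
qed

lemma unit_not_linked:
  assumes "semiclosed E (leaves R) N A" "\<not> (\<exists>Q\<in>P. Q \<subseteq> Pow A)" "X \<in> U" "X \<subseteq> A" "Z \<in> U" "Z \<subseteq> A" "X \<noteq> Z"
  shows "\<not> linked E X Z"
  using unit_closed(1)[OF assms(1,2)] assms(3-7) P_max[of X Z] unfolding U_def N_def by blast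

text \<open>No link leaves \<open>A\<close> from a unit and, by the maximality of \<open>P\<close>,
  none joins two units in \<open>A\<close>. So a link crossing a unit has its other end in
  \<open>A\<close> outside the units, and a link crossing \<open>A\<close> has its inner end there.
  This charges the cuts of the units and of \<open>A\<close> itself to different links.\<close>

lemma Y_ge_units:
  assumes A: "A \<in> R" "semiclosed E (leaves R) N A" "\<not> (\<exists>Q\<in>P. Q \<subseteq> Pow A)"
  shows "real (card {X\<in>U. X \<subseteq> A}) + 1 \<le> Y A"
proof -
  define \<X> where "\<X> = {X\<in>U. X \<subseteq> A}"
  have leaf: "\<X> \<subseteq> leaves R" unfolding \<X>_def leaves_R by blast
  have fin: "finite \<X>" using leaf finite_leaves_R finite_subset by blast
  have dis: "X \<inter> Z = {}" if "X \<in> \<X>" "Z \<in> \<X>" "X \<noteq> Z" for X Z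
    using leaves_R_disjoint leaf that by blast
  have in_unit: "v \<in> A - \<Union>U \<or> (\<exists>X\<in>\<X>. v \<in> X)" if "v \<in> A" for v
    using that leaf_R_below_or_disjoint[OF U_leaf] A(1) unfolding \<X>_def by blast
  have "tot (\<lambda>e. (\<Sum>X\<in>\<X>. of_bool (crosses e X)) + of_bool (crosses e A)) \<le> Y A"
    unfolding Y_def
  proof (rule tot_mono)
    fix e assume e: "e \<in> E"
    show "(\<Sum>X\<in>\<X>. of_bool (crosses e X)) + of_bool (crosses e A) \<le> ends (A - \<Union>U) e"
    proof (cases "\<exists>X\<in>\<X>. crosses e X")
      case True
      then obtain X where X: "X \<in> \<X>" "crosses e X" by blast
      then have XU: "X \<in> U" "X \<subseteq> A" unfolding \<X>_def by auto
      have in_A: "fst e \<in> A" "snd e \<in> A"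
        using unit_closed(2)[OF A(2,3) XU] X(2) e unfolding closed_in_def crosses_def by auto
      have other: "v \<in> A - \<Union>U" if v: "v \<in> A" "joins e X {v}" "v \<notin> X" for v
      proof (rule ccontr)
        assume "v \<notin> A - \<Union>U"
        then obtain Z where Z: "Z \<in> \<X>" "v \<in> Z" using in_unit[OF v(1)] by blast
        then have "linked E X Z" using v(2) e unfolding linked_def joins_def by blast
        moreover have "X \<noteq> Z" using Z(2) v(3) by blast
        ultimately show False using unit_not_linked[OF A(2,3) XU, of Z] Z(1) unfolding \<X>_def by blast
      qed
      have "fst e \<in> A - \<Union>U \<or> snd e \<in> A - \<Union>U"
        using X(2) in_A other[of "fst e"] other[of "snd e"] unfolding crosses_def joins_def by blast
      then have "1 \<le> ends (A - \<Union>U) e" unfolding ends_def by auto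
      moreover have "(\<Sum>X\<in>\<X>. of_bool (crosses e X)) \<le> (1::real)"
      proof -
        have "(\<Sum>X\<in>\<X>. of_bool (crosses e X)) \<le> ends (\<Union>\<X>) e"
          by (rule sum_crosses_le_ends[OF fin dis])
        moreover have "\<Union>\<X> \<inter> (A - \<Union>U) = {}" unfolding \<X>_def by blast
        then have "ends (\<Union>\<X>) e \<le> 1"
          using \<open>fst e \<in> A - \<Union>U \<or> snd e \<in> A - \<Union>U\<close> unfolding ends_def by auto
        ultimately show ?thesis by linarith
      qed
      moreover have "\<not> crosses e A" using in_A unfolding crosses_def by simp
      ultimately show ?thesis by simp
    next
      case False
      then have "(\<Sum>X\<in>\<X>. of_bool (crosses e X)) = (0::real)" by simp
      moreover have "of_bool (crosses e A) \<le> ends (A - \<Union>U) e"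
      proof (cases "crosses e A")
        case True
        then obtain v where v: "v \<in> A" "v = fst e \<or> v = snd e" unfolding crosses_def by auto
        have "v \<notin> X" if "X \<in> \<X>" for X
          using unit_closed(2)[OF A(2,3), of X] that v(2) e True
          unfolding \<X>_def closed_in_def crosses_def by blast
        then have "v \<in> A - \<Union>U" using in_unit[OF v(1)] by blast
        then show ?thesis using v(2) unfolding ends_def by auto
      qed (simp add: ends_def)
      ultimately show ?thesis by simp
    qed
  qed
  moreover have "real (card \<X>) \<le> tot (\<lambda>e. \<Sum>X\<in>\<X>. of_bool (crosses e X))"
    by (rule sum_cuts_le) (use leaf leaf_R_family fin in auto)
  ultimately show ?thesis
    using cut_tot[OF R_family[OF A(1)]] unfolding tot_add \<X>_def by linarith
qed

text \<open>Every heavy link lies inside one contracted set, so the cap takes nothing from what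
  \<open>A\<close> adds: its free leaves at rate 1 and the other ends at 3/4.\<close>

lemma gain: "W (\<Union>\<C>) + real (card {X\<in>free \<C>. X \<subseteq> A}) + 3 / 4 * Y A \<le> W (\<Union>\<C> \<union> A)"
proof -
  define D where "D = A - \<Union>\<C>"
  have "real (card {X\<in>free \<C>. X \<subseteq> A}) + 3 / 4 * tot (ends (A - \<Union>U)) \<le> W D"
  proof (rule W_ge)
    show "finite {X\<in>free \<C>. X \<subseteq> A}" using finite_U unfolding U_def by simp
    show "{X\<in>free \<C>. X \<subseteq> A} \<subseteq> Unm" unfolding free_def by blast
    show "\<Union>{X\<in>free \<C>. X \<subseteq> A} \<subseteq> D" unfolding free_def D_def by blast
    show "A - \<Union>U \<subseteq> D" "(A - \<Union>U) \<inter> \<Union>{X\<in>free \<C>. X \<subseteq> A} = {}" unfolding D_def U_def by blast+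
    show "\<not> (fst e \<in> D \<and> snd e \<in> D)" if "e \<in> E" "heavy e" for e
      using C_heavy[OF that] unfolding D_def by blast
  qed
  moreover have "W (\<Union>\<C>) + W D \<le> W (\<Union>\<C> \<union> D)"
  proof (rule W_Un)
    show "\<Union>\<C> \<inter> D = {}" unfolding D_def by blast
    show "\<not> joins e (\<Union>\<C>) D" if "e \<in> E" "heavy e" for e
      using C_heavy[OF that] unfolding D_def joins_def by blast
  qed
  moreover have "\<Union>\<C> \<union> D = \<Union>\<C> \<union> A" unfolding D_def by blast
  ultimately show ?thesis unfolding Y_def by simp
qed

lemma finite_C: "finite \<C>"
  using finite_U unfolding U_def by simp

lemma card_units_le: "card {X\<in>U. X \<subseteq> A} \<le> card {C\<in>\<C>. C \<subseteq> A} + card {X\<in>free \<C>. X \<subseteq> A}"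
proof -
  have "{X\<in>U. X \<subseteq> A} = {C\<in>\<C>. C \<subseteq> A} \<union> {X\<in>free \<C>. X \<subseteq> A}" unfolding U_def by blast
  then show ?thesis using card_Un_le[of "{C\<in>\<C>. C \<subseteq> A}" "{X\<in>free \<C>. X \<subseteq> A}"] by simp
qed

lemma state_links:
  obtains J where "J \<subseteq> E" "\<And>C S. C \<in> \<C> \<Longrightarrow> S \<in> \<L> \<Longrightarrow> S \<subset> C \<Longrightarrow> \<exists>e\<in>J. crosses e S"
    "real (card J) + real (card \<C>) \<le> W (\<Union>\<C>)"
proof -
  from state_parts(5) obtain J where J: "J \<subseteq> E"
    and c: "\<forall>C\<in>\<C>. \<forall>S\<in>\<L>. S \<subset> C \<longrightarrow> (\<exists>e\<in>J. crosses e S)"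
    and w: "real (card J) + real (card \<C>) \<le> W (\<Union>\<C>)"
    by (elim exE conjE)
  show ?thesis by (rule that[OF J _ w]) (use c in simp)
qed

text \<open>The contracted sets inside \<open>A\<close> give up their retained units, and
  \<open>gain\<close> supplies the rest; together this pays for \<open>J'\<close> and the one unit
  that \<open>A\<close> must retain.\<close>

lemma contract:
  assumes A: "A \<in> R" "semiclosed E (leaves R) N A"
    and J': "J' \<subseteq> E" "\<And>Z. Z \<in> R \<Longrightarrow> Z \<subset> A \<Longrightarrow> \<exists>e\<in>J'. crosses e Z"
    and c: "real (card J') + 1 \<le> real (card {X\<in>U. X \<subseteq> A}) + 3 / 4 * Y A"
  shows "state (insert A {C\<in>\<C>. \<not> C \<subseteq> A})"
proof -
  let ?C = "insert A {C\<in>\<C>. \<not> C \<subseteq> A}"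
  obtain J where J: "J \<subseteq> E" "\<And>C S. C \<in> \<C> \<Longrightarrow> S \<in> \<L> \<Longrightarrow> S \<subset> C \<Longrightarrow> \<exists>e\<in>J. crosses e S"
    "real (card J) + real (card \<C>) \<le> W (\<Union>\<C>)" by (rule state_links) blast
  note CA = C_below_or_disjoint[OF A(1)]
  have covered: "\<exists>e\<in>J \<union> J'. crosses e S" if C: "C \<in> ?C" "S \<in> \<L>" "S \<subset> C" for C S
  proof (cases "\<exists>C\<in>\<C>. S \<subset> C")
    case True
    then show ?thesis using J(2) C(2) by blast
  next
    case False
    then have "C = A" "S \<in> R" using C unfolding R_def by blast+
    then show ?thesis using J'(2) C(3) by blast
  qed
  \<comment> \<open>A pair of \<open>M\<close> outside \<open>Mc\<close> lies in one contracted
    \<open>D\<close>; if one of its leaves is in \<open>A\<close>, then \<open>D\<close> meets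
    \<open>A\<close> and is contained in it. Pairs in \<open>Mc\<close> are not split because
    \<open>A\<close> is semiclosed.\<close>
  have compat: "Z \<subseteq> C" if C: "Q \<in> M" "X \<in> Q" "C \<in> ?C" "X \<subseteq> C" "Z \<in> Q" for Q X C Z
  proof (cases "C \<in> \<C>")
    case True
    then show ?thesis using C_compatible C by blast
  next
    case False
    then have CA': "C = A" using C(3) by blast
    show ?thesis
    proof (cases "Q \<in> Mc")
      case True
      then show ?thesis using semiclosed_pair[OF A(2) _ C(2,5)] C(4) CA' unfolding N_def by simp
    next
      case False
      then obtain X' D where D: "X' \<in> Q" "D \<in> \<C>" "X' \<inter> D \<noteq> {}" using C(1) unfolding Mc_def by blast
      then have "X' \<subseteq> D" using leaf_C[OF M_leaf[OF C(1) D(1)] D(2)] by blast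
      then have XZ: "X \<subseteq> D" "Z \<subseteq> D" using C_compatible[OF C(1) D(1,2)] C(2,5) by blast+
      have "X \<noteq> {}" using M_leaf[OF C(1,2)] leaves_subset family_nonempty by blast
      then have "D \<subseteq> A" using CA[OF D(2)] XZ(1) C(4) CA' by blast
      then show ?thesis using XZ(2) CA' by blast
    qed
  qed
  have "card (J \<union> J') \<le> card J + card J'" by (rule card_Un_le)
  moreover have "card ?C \<le> Suc (card {C\<in>\<C>. \<not> C \<subseteq> A})"
    using finite_C by (simp add: card_insert_if)
  moreover have "card {C\<in>\<C>. C \<subseteq> A} + card {C\<in>\<C>. \<not> C \<subseteq> A} = card \<C>"
  proof -
    have "card ({C\<in>\<C>. C \<subseteq> A} \<union> {C\<in>\<C>. \<not> C \<subseteq> A}) = card {C\<in>\<C>. C \<subseteq> A} + card {C\<in>\<C>. \<not> C \<subseteq> A}"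
      by (rule card_Un_disjoint) (use finite_C in auto)
    moreover have "{C\<in>\<C>. C \<subseteq> A} \<union> {C\<in>\<C>. \<not> C \<subseteq> A} = \<C>" by blast
    ultimately show ?thesis by simp
  qed
  moreover have "\<Union>?C = \<Union>\<C> \<union> A" by blast
  ultimately have "real (card (J \<union> J')) + real (card ?C) \<le> W (\<Union>?C)"
    using gain[of A] card_units_le[of A] J(3) c by simp
  then have ex: "\<exists>J\<subseteq>E. (\<forall>C\<in>?C. \<forall>S\<in>\<L>. S \<subset> C \<longrightarrow> (\<exists>e\<in>J. crosses e S)) \<and>
       real (card J) + real (card ?C) \<le> W (\<Union>?C)"
    using covered J(1) J'(1) by (intro exI[of _ "J \<union> J'"]) simp
  have heavy: "\<exists>C\<in>?C. fst e \<in> C \<and> snd e \<in> C" if "e \<in> E" "heavy e" for e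
    using C_heavy[OF that] by blast
  have fam: "?C \<subseteq> \<L>" using C_family R_family[OF A(1)] by blast
  have dis: "C \<inter> D = {}" if CD: "C \<in> ?C" "D \<in> ?C" "C \<noteq> D" for C D
  proof (cases "C = A \<or> D = A")
    case True
    then show ?thesis using CD CA[of C] CA[of D] by auto
  next
    case False
    then show ?thesis using CD C_disjoint[of C D] by simp
  qed
  show ?thesis
    unfolding state_def by (intro conjI ballI impI; (rule fam ex dis heavy compat)?; assumption?)
qed

text \<open>The last step is cheaper by 1, since no contracted set remains that would have to retain
  a unit.\<close>

lemma finish:
  assumes "J' \<subseteq> E" "\<And>Z. Z \<in> R \<Longrightarrow> \<exists>e\<in>J'. crosses e Z"
    and c: "real (card J') \<le> real (card U) + 3 / 4 * Y UNIV"
  shows "\<exists>J\<subseteq>E. (\<forall>S\<in>\<L>. \<exists>e\<in>J. crosses e S) \<and> real (card J) \<le> 7 / 4 * (\<Sum>e\<in>E. x e)"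
proof -
  obtain J where J: "J \<subseteq> E" "\<And>C S. C \<in> \<C> \<Longrightarrow> S \<in> \<L> \<Longrightarrow> S \<subset> C \<Longrightarrow> \<exists>e\<in>J. crosses e S"
    "real (card J) + real (card \<C>) \<le> W (\<Union>\<C>)" by (rule state_links) blast
  have "\<exists>e\<in>J \<union> J'. crosses e S" if "S \<in> \<L>" for S
    using J(2) assms(2)[of S] that unfolding R_def by blast
  moreover have "card (J \<union> J') \<le> card J + card J'" by (rule card_Un_le)
  then have "real (card (J \<union> J')) \<le> 7 / 4 * (\<Sum>e\<in>E. x e)"
    using gain[of UNIV] card_units_le[of UNIV] J(3) c W_UNIV by simp
  ultimately show ?thesis using J(1) assms(1) by (intro exI[of _ "J \<union> J'"]) auto
qed

end

section \<open>Finding a set to contract\<close>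

context contracted
begin

abbreviation "sc \<equiv> semiclosed E (leaves R) N"

text \<open>With \<open>u\<close> units, \<open>m\<close> pairs in \<open>Mc\<close> and
  \<open>p\<close> pairs in \<open>P\<close>, a cover has up to u + m - p links. This is the
  negation of what \<open>contract\<close> then requires, u + m - p + 1 \<le> u + 3/4 Y.\<close>

definition deficient :: "'v set \<Rightarrow> bool" where
  "deficient A \<longleftrightarrow> 3 / 4 * Y A + real (card {Q\<in>P. Q \<subseteq> Pow A}) < real (card {Q\<in>Mc. Q \<subseteq> Pow A}) + 1"

lemma leaf_below_cases:
  assumes "sc A" "X \<in> leaves R" "X \<subseteq> A"
  shows "X \<in> U \<or> (\<exists>Q\<in>Mc. X \<in> Q \<and> Q \<subseteq> Pow A)"
proof (cases "X \<in> U")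
  case False
  then obtain Q where Q: "Q \<in> Mc" "X \<in> Q" using assms(2) unfolding leaves_R by blast
  then have "Z \<subseteq> A" if "Z \<in> Q" for Z
    using semiclosed_pair[OF assms(1) _ Q(2) that assms(3)] unfolding N_def by simp
  then show ?thesis using Q by blast
qed simp

text \<open>
  A deficient set without units would consist of two matched leaves only, which were then twins.
\<close>

lemma deficient_has_unit:
  assumes A: "A \<in> R" "sc A" and m: "{Q\<in>Mc. Q \<subseteq> Pow A} = {Q0}"
  shows "{X\<in>U. X \<subseteq> A} \<noteq> {}"
proof
  assume u: "{X\<in>U. X \<subseteq> A} = {}"
  have Q0: "Q0 \<in> Mc" "Q0 \<subseteq> Pow A" using m by blast+
  then have "Q0 \<in> M" unfolding Mc_def by simp
  then obtain b b' where b: "Q0 = {b, b'}" "\<not> twin b b'" by (rule matchingE[OF M]) blast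
  have only: "Z = b \<or> Z = b'" if Z: "Z \<in> leaves \<L>" "Z \<subseteq> A" for Z
  proof (cases "\<exists>C\<in>\<C>. Z \<inter> C \<noteq> {}")
    case True
    then obtain C where C: "C \<in> \<C>" "Z \<inter> C \<noteq> {}" by blast
    then have "C \<subseteq> A" using C_below_or_disjoint[OF A(1) C(1)] Z(2) by blast
    then show ?thesis using C(1) u unfolding U_def by blast
  next
    case False
    then have "Z \<in> leaves R" using Z(1) leaves_R_iff by simp
    then obtain Q where "Q \<in> Mc" "Z \<in> Q" "Q \<subseteq> Pow A"
      using leaf_below_cases[OF A(2) _ Z(2)] u Z(2) by blast
    then show ?thesis using m b(1) by blast
  qed
  have "b \<subseteq> A" "b' \<subseteq> A" using Q0(2) b(1) by blast+
  then have "twin b b'"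
    unfolding twin_def by (intro bexI[OF _ R_family[OF A(1)]] conjI ballI impI only)
  then show False using b(2) by simp
qed

text \<open>With m, p, u as before, Y \<ge> 2 m always. Thus p \<ge> 1 or m \<ge> 2 would suffice.
  If p = 0, then also Y \<ge> u + 1; m = 0 forces a unit as leaf, so 3/4 Y \<ge> 3/2 would suffice.
  In the remaining case m = 1 and Y < 8/3, which gives u < 2.\<close>

lemma deficientD:
  assumes A: "A \<in> R" "sc A" and d: "deficient A"
  shows "\<not> (\<exists>Q\<in>P. Q \<subseteq> Pow A)" "card {Q\<in>Mc. Q \<subseteq> Pow A} = 1" "card {X\<in>U. X \<subseteq> A} = 1" "Y A < 8 / 3"
proof -
  let ?m = "card {Q\<in>Mc. Q \<subseteq> Pow A}" and ?p = "card {Q\<in>P. Q \<subseteq> Pow A}" and ?u = "card {X\<in>U. X \<subseteq> A}"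
  note Ym = Y_ge_pairs[of A]
  have d': "3 / 4 * Y A + real ?p < real ?m + 1" using d unfolding deficient_def .
  have p0: "?p = 0"
  proof (rule ccontr)
    assume "?p \<noteq> 0"
    then have "1 \<le> real ?p" by simp
    moreover have "0 \<le> real ?m" by simp
    ultimately show False using d' Ym by argo
  qed
  then show nP: "\<not> (\<exists>Q\<in>P. Q \<subseteq> Pow A)" using finite_P by auto
  note Yu = Y_ge_units[OF A nP]
  have "?m \<noteq> 0"
  proof
    assume m0: "?m = 0"
    obtain X where X: "X \<in> leaves R" "X \<subseteq> A" by (rule ex_leaf_below[OF finite_R A(1)])
    have "{Q\<in>Mc. Q \<subseteq> Pow A} = {}" using m0 finite_Mc by simp
    then have "X \<in> {X\<in>U. X \<subseteq> A}" using leaf_below_cases[OF A(2) X] X(2) by blast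
    then have "?u \<noteq> 0" using finite_U by auto
    then have "1 \<le> real ?u" by simp
    then show False using Yu d' m0 by simp
  qed
  moreover have "real ?m < 2" using Ym d' p0 by simp
  ultimately show m1: "?m = 1" by linarith
  then show "Y A < 8 / 3" using d' p0 by simp
  then have "real ?u < 2" using Yu by simp
  moreover obtain Q0 where "{Q\<in>Mc. Q \<subseteq> Pow A} = {Q0}" using m1 card_1_singletonE by blast
  then have "{X\<in>U. X \<subseteq> A} \<noteq> {}" by (rule deficient_has_unit[OF A])
  then have "?u \<noteq> 0" using finite_U by simp
  ultimately show "?u = 1" by linarith
qed

text \<open>The data of an exchange of \<open>{p, p'}\<close> for \<open>{a, p}\<close>. Taking
  \<open>Z = D\<close>, the last two clauses show that some link leaves \<open>D\<close> from
  \<open>p'\<close>.\<close>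

definition dangerous :: "'v set \<Rightarrow> 'v set \<Rightarrow> 'v set \<Rightarrow> 'v set \<Rightarrow> bool" where
  "dangerous D a p p' \<longleftrightarrow> a \<in> U \<and> a \<notin> \<Union>N \<and> closed_in E a D \<and> {p, p'} \<in> Mc \<and> p \<noteq> p' \<and>
     {X\<in>leaves R. X \<subseteq> D} = {a, p, p'} \<and> linked E a p \<and>
     (\<forall>S\<in>\<L>. a \<subseteq> S \<longrightarrow> p \<subseteq> S \<longrightarrow> p' \<subseteq> S) \<and>
     (\<forall>Z\<in>\<L>. D \<subseteq> Z \<longrightarrow> closed_in E p' Z \<longrightarrow> 8 / 3 \<le> tot (ends (Z - a))) \<and>
     tot (ends (D - a)) < 8 / 3"

lemma Y_single_unit:
  assumes "A \<in> R" "{X\<in>U. X \<subseteq> A} = {a}"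
  shows "Y A = tot (ends (A - a))"
proof -
  have "X \<inter> A = {}" if "X \<in> U" "X \<noteq> a" for X
    using leaf_R_below_or_disjoint[OF U_leaf[OF that(1)], of A] assms that by blast
  moreover have "a \<in> U" using assms(2) by blast
  ultimately have "A - \<Union>U = A - a" by blast
  then show ?thesis unfolding Y_def by simp
qed

lemma deficient_dangerous:
  assumes A: "D \<in> R" "sc D" and d: "deficient D"
  shows "\<exists>a p p'. dangerous D a p p'"
proof -
  note D = deficientD[OF A d]
  obtain a where a: "{X\<in>U. X \<subseteq> D} = {a}" using D(3) card_1_singletonE by blast
  obtain Q0 where Q0: "{Q\<in>Mc. Q \<subseteq> Pow D} = {Q0}" using D(2) card_1_singletonE by blast
  then have Q0': "Q0 \<in> Mc" "Q0 \<subseteq> Pow D" by blast+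
  obtain b b' where b: "Q0 = {b, b'}" "b \<noteq> b'" by (rule matchingE[OF Mc_matching Q0'(1)]) blast
  have aU: "a \<in> U" "a \<subseteq> D" using a by blast+
  have leaf: "a \<in> leaves R" "b \<in> leaves R" "b' \<in> leaves R"
    using U_leaf[OF aU(1)] Mc_leaf[OF Q0'(1)] b(1) by auto
  have ne: "a \<noteq> b" "a \<noteq> b'" using aU(1) U_Mc_disjoint Q0'(1) b(1) by blast+
  have leaves: "{X\<in>leaves R. X \<subseteq> D} = {a, b, b'}"
  proof (intro subset_antisym subsetI)
    fix X assume "X \<in> {X\<in>leaves R. X \<subseteq> D}"
    then have "X \<in> {X\<in>U. X \<subseteq> D} \<or> (\<exists>Q\<in>{Q\<in>Mc. Q \<subseteq> Pow D}. X \<in> Q)"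
      using leaf_below_cases[OF A(2), of X] by blast
    then show "X \<in> {a, b, b'}" unfolding a Q0 using b(1) by blast
  next
    fix X assume "X \<in> {a, b, b'}"
    then show "X \<in> {X\<in>leaves R. X \<subseteq> D}" using leaf aU(2) Q0'(2) b(1) by blast
  qed
  note cl = unit_closed[OF A(2) D(1) aU]
  have "\<exists>p p'. {p, p'} = {b, b'} \<and> linked E a p \<and> (\<forall>S\<in>\<L>. a \<subseteq> S \<longrightarrow> p \<subseteq> S \<longrightarrow> p' \<subseteq> S) \<and>
      (\<forall>Z\<in>\<L>. D \<subseteq> Z \<longrightarrow> closed_in E p' Z \<longrightarrow> 8 / 3 \<le> tot (ends (Z - a)))"
  proof (rule ex_switch[where a = a and b = b and b' = b' and D = D])
    show "a \<in> \<L>" "b \<in> \<L>" "b' \<in> \<L>" using leaf leaf_R_family by blast+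
    show "D \<in> \<L>" using A(1) R_family by blast
    show "a \<inter> b = {}" by (rule leaves_R_disjoint[OF leaf(1,2) ne(1)])
    show "a \<inter> b' = {}" by (rule leaves_R_disjoint[OF leaf(1,3) ne(2)])
    show "b \<inter> b' = {}" by (rule leaves_R_disjoint[OF leaf(2,3) b(2)])
    show "a \<subseteq> D" "b \<subseteq> D" "b' \<subseteq> D" using aU(2) Q0'(2) b(1) by blast+
    show "closed_in E a D" by (rule cl(2))
    show "tot (ends (D - a)) < 8 / 3" using D(4) Y_single_unit[OF A(1) a] by simp
  qed
  then obtain p p' where p: "{p, p'} = {b, b'}" "linked E a p"
    "\<forall>S\<in>\<L>. a \<subseteq> S \<longrightarrow> p \<subseteq> S \<longrightarrow> p' \<subseteq> S"
    "\<forall>Z\<in>\<L>. D \<subseteq> Z \<longrightarrow> closed_in E p' Z \<longrightarrow> 8 / 3 \<le> tot (ends (Z - a))"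
    by (elim exE conjE)
  have pp1: "{p, p'} \<in> Mc" unfolding p(1) using b(1) Q0'(1) by simp
  have pp2: "p \<noteq> p'"
  proof
    assume "p = p'"
    then have "{b, b'} = {p}" using p(1) by simp
    then have "b = p" "b' = p" by blast+
    then show False using b(2) by simp
  qed
  have pp3: "{X\<in>leaves R. X \<subseteq> D} = {a, p, p'}" unfolding leaves p(1) ..
  have "tot (ends (D - a)) < 8 / 3" using D(4) Y_single_unit[OF A(1) a] by simp
  then have "dangerous D a p p'"
    unfolding dangerous_def by (intro conjI aU(1) cl pp1 pp2 pp3 p(2-4))
  then show ?thesis by blast
qed

definition minimal_sc :: "'v set set" where
  "minimal_sc = {D\<in>R. sc D \<and> (\<forall>Z\<in>R. Z \<subset> D \<longrightarrow> \<not> sc Z)}"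

lemma minimal_sc_disjoint:
  assumes "D \<in> minimal_sc" "D' \<in> minimal_sc" "D \<inter> D' \<noteq> {}"
  shows "D = D'"
proof -
  have "D \<in> R" "D' \<in> R" "\<not> D \<subset> D'" "\<not> D' \<subset> D" using assms(1,2) unfolding minimal_sc_def by auto
  then show ?thesis using laminarD[OF laminar_R, of D D'] assms(3) by blast
qed

lemma UNIV_notin: "UNIV \<notin> \<L>"
  using crossed[of UNIV] unfolding crosses_def by auto

text \<open>\<open>UNIV\<close> is semiclosed for every matching, so adding it to \<open>R\<close>
  guarantees that a minimal set exists.\<close>

lemma ex_minimal_semiclosed:
  obtains A where "A \<in> R \<or> A = UNIV" "semiclosed E (leaves R) \<mu> A"
    "\<And>Z. Z \<in> R \<Longrightarrow> Z \<subset> A \<Longrightarrow> \<not> semiclosed E (leaves R) \<mu> Z"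
proof -
  have "semiclosed E (leaves R) \<mu> UNIV" by (rule semiclosedI) (auto simp: closed_in_def)
  then have in_: "UNIV \<in> {A \<in> insert UNIV R. semiclosed E (leaves R) \<mu> A}" by simp
  have fin: "finite {A \<in> insert UNIV R. semiclosed E (leaves R) \<mu> A}" using finite_R by simp
  obtain A where A: "A \<in> {A \<in> insert UNIV R. semiclosed E (leaves R) \<mu> A}"
    and min: "\<And>Z. Z \<in> {A \<in> insert UNIV R. semiclosed E (leaves R) \<mu> A} \<Longrightarrow> Z \<subseteq> A \<Longrightarrow> Z = A"
    by (rule ex_minimal_subset[OF fin in_]) blast
  show ?thesis
  proof (rule that[of A])
    show "A \<in> R \<or> A = UNIV" "semiclosed E (leaves R) \<mu> A" using A by auto
    show "\<not> semiclosed E (leaves R) \<mu> Z" if "Z \<in> R" "Z \<subset> A" for Z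
      using min[of Z] that by auto
  qed
qed

lemma cover:
  assumes "matching (leaves R) (linked E) \<mu>" "semiclosed E (leaves R) \<mu> A"
    "\<And>Z. Z \<in> R \<Longrightarrow> Z \<subset> A \<Longrightarrow> \<not> semiclosed E (leaves R) \<mu> Z"
  obtains J where "J \<subseteq> E" "\<And>Z. Z \<in> R \<Longrightarrow> Z \<subset> A \<Longrightarrow> \<exists>e\<in>J. crosses e Z"
    "card J + card {Q\<in>\<mu>. Q \<subseteq> Pow A} \<le> card {X\<in>leaves R. X \<subseteq> A}"
proof (rule minimal_semiclosed_cover[OF finite_R finite_links laminar_R])
  show "{} \<notin> R" using R_family empty_notin by blast
  show "\<exists>e\<in>E. crosses e Z" if "Z \<in> R" for Z by (rule crossed[OF R_family[OF that]])
  show "matching (leaves R) (linked E) \<mu>" "semiclosed E (leaves R) \<mu> A" by (rule assms)+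
  show "\<not> semiclosed E (leaves R) \<mu> Z" if "Z \<in> R" "Z \<subset> A" for Z by (rule assms(3)[OF that])
qed (rule that)

text \<open>
  When every minimal semiclosed set is deficient, the matching is exchanged inside all of them at
  once. A set that is minimal semiclosed for the new matching is semiclosed for the old one too, and
  contains as many pairs.
\<close>

lemma switched_cover:
  assumes def: "\<And>D. D \<in> minimal_sc \<Longrightarrow> deficient D"
  obtains A J where "A \<in> R \<or> A = UNIV" "sc A" "\<not> (A \<in> R \<and> deficient A)" "J \<subseteq> E"
    "\<And>Z. Z \<in> R \<Longrightarrow> Z \<subset> A \<Longrightarrow> \<exists>e\<in>J. crosses e Z"
    "card J + card {Q\<in>N. Q \<subseteq> Pow A} \<le> card {X\<in>leaves R. X \<subseteq> A}"
proof -
  let ?DD = minimal_sc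
  have R: "D \<in> R" "sc D" if "D \<in> ?DD" for D using that unfolding minimal_sc_def by auto
  have fin: "finite ?DD" using finite_R unfolding minimal_sc_def by simp
  have "\<forall>D\<in>?DD. \<exists>a p p'. dangerous D a p p'" using deficient_dangerous R def by blast
  then obtain a p p' where dang: "\<And>D. D \<in> ?DD \<Longrightarrow> dangerous D (a D) (p D) (p' D)" by metis
  have leafs: "{X\<in>leaves R. X \<subseteq> D} = {a D, p D, p' D}" if "D \<in> ?DD" for D
    using dang[OF that] unfolding dangerous_def by simp
  have leaf: "a D \<in> leaves R" "p D \<in> leaves R" "p' D \<in> leaves R" "a D \<subseteq> D" "p D \<subseteq> D" "p' D \<subseteq> D"
    if "D \<in> ?DD" for D
    using leafs[OF that] by blast+
  have aN: "a D \<notin> \<Union>N" if "D \<in> ?DD" for D using dang[OF that] unfolding dangerous_def by simp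
  have pp: "{p D, p' D} \<in> N" "p D \<noteq> p' D" if "D \<in> ?DD" for D
    using dang[OF that] unfolding dangerous_def N_def by simp_all
  have pN: "p D \<in> \<Union>N" "p' D \<in> \<Union>N" if "D \<in> ?DD" for D using pp(1)[OF that] by blast+
  have ap: "a D \<noteq> p D" "linked E (a D) (p D)" if "D \<in> ?DD" for D
    using aN[OF that] pN[OF that] dang[OF that] unfolding dangerous_def by auto
  have ne: "X \<noteq> {}" if "X \<in> leaves R" for X using leaf_R_family[OF that] family_nonempty by blast
  have same: "D = D'" if "D \<in> ?DD" "D' \<in> ?DD" "X \<in> leaves R" "X \<subseteq> D" "X \<subseteq> D'" for D D' X
    using minimal_sc_disjoint[OF that(1,2)] ne[OF that(3)] that(4,5) by blast
  \<comment> \<open>\<open>B\<close> consists of the pairs that lie in no set of \<open>?DD\<close>.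
    Inside each such \<open>D\<close>, the pair \<open>{p D, p' D}\<close> gives way to
    \<open>s D\<close>, which leaves \<open>p' D\<close> unmatched.\<close>
  define B where "B = {Q\<in>N. \<forall>D\<in>?DD. \<not> Q \<subseteq> Pow D}"
  define s where "s D = {a D, p D}" for D
  define \<mu> where "\<mu> = B \<union> s ` ?DD"
  have s_sub: "s D \<subseteq> Pow D" if "D \<in> ?DD" for D using leaf[OF that] unfolding s_def by simp
  have pair: "Q = {p D, p' D}" if "Q \<in> N" "D \<in> ?DD" "Q \<inter> {p D, p' D} \<noteq> {}" for Q D
    using N_disjoint[OF that(1) pp(1)[OF that(2)]] that(3) by blast
  have Bs: "Q \<inter> s D = {}" if Q: "Q \<in> B" and D: "D \<in> ?DD" for Q D
  proof (rule ccontr)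
    assume "Q \<inter> s D \<noteq> {}"
    moreover have "a D \<notin> Q" using aN[OF D] Q unfolding B_def by blast
    ultimately have "Q = {p D, p' D}" using pair[OF _ D] Q unfolding B_def s_def by blast
    then have "Q \<subseteq> Pow D" using leaf[OF D] by simp
    then show False using Q D unfolding B_def by simp
  qed
  have ss: "s D \<inter> s D' = {}" if D: "D \<in> ?DD" "D' \<in> ?DD" "D \<noteq> D'" for D D'
  proof (rule ccontr)
    assume "s D \<inter> s D' \<noteq> {}"
    then obtain X where X: "X \<in> s D" "X \<in> s D'" by blast
    have "X \<in> leaves R" using X(1) leaf[OF D(1)] unfolding s_def by auto
    then show False using same[OF D(1,2)] X s_sub[OF D(1)] s_sub[OF D(2)] D(3) by blast
  qed
  have \<mu>: "matching (leaves R) (linked E) \<mu>"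
    unfolding matching_def
  proof (intro conjI ballI impI)
    fix Q assume "Q \<in> \<mu>"
    then consider "Q \<in> N" | D where "D \<in> ?DD" "Q = s D" unfolding \<mu>_def B_def by blast
    then show "\<exists>X\<in>leaves R. \<exists>Z\<in>leaves R. Q = {X, Z} \<and> X \<noteq> Z \<and> linked E X Z"
    proof cases
      case 1
      then show ?thesis by (rule matchingE[OF N_matching]) blast
    next
      case 2
      then show ?thesis using leaf[OF 2(1)] ap[OF 2(1)] unfolding s_def by blast
    qed
  next
    fix Q Q' assume Q: "Q \<in> \<mu>" "Q' \<in> \<mu>" "Q \<noteq> Q'"
    consider "Q \<in> B" "Q' \<in> B" | D where "D \<in> ?DD" "Q = s D" "Q' \<in> B" | D where "D \<in> ?DD" "Q' = s D" "Q \<in> B"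
      | D D' where "D \<in> ?DD" "Q = s D" "D' \<in> ?DD" "Q' = s D'"
      using Q(1,2) unfolding \<mu>_def by blast
    then show "Q \<inter> Q' = {}"
    proof cases
      case 1
      then show ?thesis using N_disjoint[of Q Q'] Q(3) unfolding B_def by simp
    next
      case 2
      then show ?thesis using Bs[of Q' D] by blast
    next
      case 3
      then show ?thesis using Bs[of Q D] by blast
    next
      case 4
      then show ?thesis using ss[of D D'] Q(3) by blast
    qed
  qed
  have p'\<mu>: "p' D \<notin> \<Union>\<mu>" if D: "D \<in> ?DD" for D
  proof
    assume "p' D \<in> \<Union>\<mu>"
    then consider Q where "Q \<in> B" "p' D \<in> Q" | D' where "D' \<in> ?DD" "p' D \<in> s D'"
      unfolding \<mu>_def by blast
    then show False
    proof cases
      case 1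
      then have "Q = {p D, p' D}" using pair[OF _ D] unfolding B_def by blast
      then show False using Bs[OF 1(1) D] unfolding s_def by blast
    next
      case 2
      then have "p' D \<subseteq> D'" using s_sub by blast
      then have "D = D'" using same[OF D 2(1) leaf(3)[OF D] leaf(6)[OF D]] by blast
      then show False using 2(2) aN[OF D] pN[OF D] pp(2)[OF D] unfolding s_def by auto
    qed
  qed
  obtain A where A: "A \<in> R \<or> A = UNIV" "semiclosed E (leaves R) \<mu> A"
    and min: "\<And>Z. Z \<in> R \<Longrightarrow> Z \<subset> A \<Longrightarrow> \<not> semiclosed E (leaves R) \<mu> Z"
    by (rule ex_minimal_semiclosed) blast
  have p'_not_closed: "\<not> (closed_in E (p' D) Z)" if D: "D \<in> ?DD" "Z \<subseteq> D" for D Z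
  proof
    assume "closed_in E (p' D) Z"
    then have "closed_in E (p' D) D" using D(2) unfolding closed_in_def by blast
    then have "8 / 3 \<le> tot (ends (D - a D))"
      using dang[OF D(1)] R_family[OF R(1)[OF D(1)]] unfolding dangerous_def by blast
    then show False using dang[OF D(1)] unfolding dangerous_def by linarith
  qed
  \<comment> \<open>If \<open>A\<close> were inside \<open>D\<close>, it would contain one of the
    three leaves. With \<open>a D\<close> or \<open>p D\<close> it contains the new pair, hence also
    \<open>p' D\<close>, which no set separates from it. So the unmatched \<open>p' D\<close> would
    be closed in a subset of \<open>D\<close>.\<close>
  have not_below: "\<not> A \<subseteq> D" if D: "D \<in> ?DD" for D
  proof
    assume AD: "A \<subseteq> D"
    have "D \<noteq> UNIV" using UNIV_notin R_family[OF R(1)[OF D]] by blast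
    then have AR: "A \<in> R" using A(1) AD by blast
    obtain X where X: "X \<in> leaves R" "X \<subseteq> A" by (rule ex_leaf_below[OF finite_R AR])
    have "X \<in> {a D, p D, p' D}" using X AD leafs[OF D] by blast
    moreover have "p' D \<subseteq> A" if "X \<in> s D"
    proof -
      have "a D \<subseteq> A" "p D \<subseteq> A"
        using semiclosed_pair[OF A(2) _ that _ X(2)] D unfolding \<mu>_def s_def by blast+
      then show ?thesis using dang[OF D] R_family[OF AR] unfolding dangerous_def by blast
    qed
    ultimately have "p' D \<subseteq> A" using X(2) unfolding s_def by blast
    then have "closed_in E (p' D) A" by (rule semiclosed_single[OF A(2) leaf(3)[OF D] p'\<mu>[OF D]])
    then show False using p'_not_closed[OF D AD] by blast
  qed
  have above: "D \<subseteq> A" if D: "D \<in> ?DD" "X \<in> leaves R" "X \<subseteq> D" "X \<subseteq> A" for D X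
  proof (cases "A = UNIV")
    case False
    then have "A \<in> R" using A(1) by simp
    then show ?thesis using laminarD[OF laminar_R R(1)[OF D(1)]] not_below[OF D(1)] ne[OF D(2)] D(3,4) by blast
  qed simp
  \<comment> \<open>By \<open>above\<close>, a set \<open>D\<close> of which \<open>A\<close>
    contains a leaf lies in \<open>A\<close> entirely. Old pairs inside \<open>D\<close> are thus
    not split, and \<open>a D\<close>, unmatched for \<open>N\<close>, is closed already in
    \<open>D\<close>.\<close>
  have scA: "sc A"
  proof (rule semiclosedI)
    fix Q X Z assume Q: "Q \<in> N" "X \<in> Q" "Z \<in> Q" "X \<subseteq> A"
    have X: "X \<in> leaves R" using matching_subset[OF N_matching] Q(1,2) by blast
    show "Z \<subseteq> A"
    proof (cases "Q \<in> B")
      case True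
      then show ?thesis using semiclosed_pair[OF A(2) _ Q(2,3,4)] unfolding \<mu>_def by blast
    next
      case False
      then obtain D where D: "D \<in> ?DD" "Q \<subseteq> Pow D" using Q(1) unfolding B_def by blast
      then have "D \<subseteq> A" using above[OF D(1) X _ Q(4)] Q(2) by blast
      then show ?thesis using D(2) Q(3) by blast
    qed
  next
    fix X assume X: "X \<in> leaves R" "X \<notin> \<Union>N" "X \<subseteq> A"
    show "closed_in E X A"
    proof (cases "X \<in> \<Union>\<mu>")
      case False
      then show ?thesis by (rule semiclosed_single[OF A(2) X(1) _ X(3)])
    next
      case True
      then obtain D where D: "D \<in> ?DD" "X \<in> s D" using X(2) unfolding \<mu>_def B_def by blast
      then have Xa: "X = a D" using X(2) pN[OF D(1)] unfolding s_def by blast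
      have "D \<subseteq> A" using above[OF D(1) X(1) _ X(3)] leaf(4)[OF D(1)] Xa by blast
      moreover have "closed_in E X D" using dang[OF D(1)] Xa unfolding dangerous_def by simp
      ultimately show ?thesis unfolding closed_in_def by blast
    qed
  qed
  \<comment> \<open>An old pair in \<open>A\<close> that was given up belongs to some
    \<open>D\<close> inside \<open>A\<close>, where \<open>s D\<close> replaces it; distinct
    \<open>D\<close> have disjoint \<open>s D\<close>.\<close>
  have card: "card {Q\<in>N. Q \<subseteq> Pow A} \<le> card {Q\<in>\<mu>. Q \<subseteq> Pow A}"
  proof -
    let ?K = "{D\<in>?DD. D \<subseteq> A}" and ?B = "{Q\<in>B. Q \<subseteq> Pow A}"
    have finB: "finite ?B" using matching_finite[OF finite_leaves_R N_matching] unfolding B_def by simp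
    have "{Q\<in>N. Q \<subseteq> Pow A} \<subseteq> ?B \<union> (\<lambda>D. {p D, p' D}) ` ?K"
    proof
      fix Q assume Q: "Q \<in> {Q\<in>N. Q \<subseteq> Pow A}"
      show "Q \<in> ?B \<union> (\<lambda>D. {p D, p' D}) ` ?K"
      proof (cases "Q \<in> B")
        case False
        then obtain D where D: "D \<in> ?DD" "Q \<subseteq> Pow D" using Q unfolding B_def by blast
        have QN: "Q \<in> N" "Q \<subseteq> Pow A" using Q by auto
        obtain X where X: "X \<in> Q" "X \<in> leaves R" by (rule matchingE[OF N_matching QN(1)]) blast
        have "D \<subseteq> A" using above[OF D(1) X(2)] X(1) D(2) QN(2) by blast
        moreover have "X \<in> {a D, p D, p' D}" using leafs[OF D(1)] X D(2) by blast
        then have "X \<in> {p D, p' D}" using aN[OF D(1)] X(1) QN(1) by blast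
        then have "Q = {p D, p' D}" using pair[OF QN(1) D(1)] X(1) by blast
        ultimately show ?thesis using D(1) by blast
      qed (use Q in simp)
    qed
    then have "card {Q\<in>N. Q \<subseteq> Pow A} \<le> card (?B \<union> (\<lambda>D. {p D, p' D}) ` ?K)"
      by (rule card_mono[rotated]) (use fin finB in simp)
    also have "\<dots> \<le> card ?B + card ((\<lambda>D. {p D, p' D}) ` ?K)" by (rule card_Un_le)
    also have "\<dots> \<le> card ?B + card ?K" using card_image_le[of ?K] fin by simp
    also have "card ?K = card (s ` ?K)"
    proof (rule card_image[symmetric], rule inj_onI)
      fix D D' assume D: "D \<in> ?K" "D' \<in> ?K" "s D = s D'"
      show "D = D'"
      proof (rule ccontr)
        assume "D \<noteq> D'"
        then have "s D \<inter> s D' = {}" using ss D(1,2) by blast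
        then show False using D(3) unfolding s_def by blast
      qed
    qed
    also have "card ?B + card (s ` ?K) = card (?B \<union> s ` ?K)"
    proof (rule card_Un_disjoint[symmetric])
      show "finite ?B" by (rule finB)
      show "finite (s ` ?K)" using fin by simp
      show "?B \<inter> s ` ?K = {}"
      proof (rule ccontr)
        assume "?B \<inter> s ` ?K \<noteq> {}"
        then obtain D where "D \<in> ?DD" "s D \<in> B" by blast
        then have "s D = {}" using Bs[of "s D" D] by blast
        then show False unfolding s_def by simp
      qed
    qed
    also have "\<dots> \<le> card {Q\<in>\<mu>. Q \<subseteq> Pow A}"
    proof (rule card_mono)
      show "finite {Q\<in>\<mu>. Q \<subseteq> Pow A}" using matching_finite[OF finite_leaves_R \<mu>] by simp
      have "s D \<subseteq> Pow A" if "D \<in> ?K" for D using s_sub[of D] that by blast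
      then show "?B \<union> s ` ?K \<subseteq> {Q\<in>\<mu>. Q \<subseteq> Pow A}" unfolding \<mu>_def by blast
    qed
    finally show ?thesis .
  qed
  \<comment> \<open>A deficient \<open>A\<close> would have a single unit, namely \<open>a D\<close>
    for a minimal \<open>D\<close> inside it. But \<open>p' D\<close> is unmatched for the new
    matching, hence closed in \<open>A\<close>, and the choice of \<open>p D\<close> gives weight
    8/3.\<close>
  have good: "\<not> (A \<in> R \<and> deficient A)"
  proof
    assume AR: "A \<in> R \<and> deficient A"
    then have AR': "A \<in> R" by simp
    note dA = deficientD[OF AR' scA conjunct2[OF AR]]
    have "finite {Z\<in>R. sc Z}" "A \<in> {Z\<in>R. sc Z}" using finite_R AR' scA by auto
    then obtain D where D: "D \<in> {Z\<in>R. sc Z}" "D \<subseteq> A" "\<And>Z. Z \<in> {Z\<in>R. sc Z} \<Longrightarrow> Z \<subseteq> D \<Longrightarrow> Z = D"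
      by (rule ex_minimal_subset) blast
    have DD: "D \<in> ?DD" unfolding minimal_sc_def using D(1) D(3) by blast
    have "a D \<in> U" using dang[OF DD] unfolding dangerous_def by (rule conjunct1)
    then have "a D \<in> {X\<in>U. X \<subseteq> A}" using leaf(4)[OF DD] D(2) by blast
    moreover obtain c where c: "{X\<in>U. X \<subseteq> A} = {c}" using dA(3) card_1_singletonE by blast
    ultimately have U1: "{X\<in>U. X \<subseteq> A} = {a D}" by simp
    have "p' D \<subseteq> A" using leaf(6)[OF DD] D(2) by blast
    then have "closed_in E (p' D) A" by (rule semiclosed_single[OF A(2) leaf(3)[OF DD] p'\<mu>[OF DD]])
    then have "8 / 3 \<le> tot (ends (A - a D))"
      using dang[OF DD] R_family[OF AR'] D(2) unfolding dangerous_def by blast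
    then show False using dA(4) Y_single_unit[OF AR' U1] by simp
  qed
  obtain J where J: "J \<subseteq> E" "\<And>Z. Z \<in> R \<Longrightarrow> Z \<subset> A \<Longrightarrow> \<exists>e\<in>J. crosses e Z"
    "card J + card {Q\<in>\<mu>. Q \<subseteq> Pow A} \<le> card {X\<in>leaves R. X \<subseteq> A}"
    by (rule cover[OF \<mu> A(2)]) (use min in \<open>simp_all\<close>)
  have Jc: "card J + card {Q\<in>N. Q \<subseteq> Pow A} \<le> card {X\<in>leaves R. X \<subseteq> A}" using J(3) card by linarith
  show ?thesis by (rule that[OF A(1) scA good J(1) _ Jc]) (rule J(2))
qed

text \<open>If no set of \<open>R\<close> is semiclosed for \<open>N\<close>, the first case holds
  vacuously and yields \<open>UNIV\<close>.\<close>

lemma good_cover: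
  obtains A J where "A \<in> R \<or> A = UNIV" "sc A" "\<not> (A \<in> R \<and> deficient A)" "J \<subseteq> E"
    "\<And>Z. Z \<in> R \<Longrightarrow> Z \<subset> A \<Longrightarrow> \<exists>e\<in>J. crosses e Z"
    "card J + card {Q\<in>N. Q \<subseteq> Pow A} \<le> card {X\<in>leaves R. X \<subseteq> A}"
proof (cases "\<forall>D\<in>minimal_sc. deficient D")
  case True
  show ?thesis by (rule switched_cover) (use True that in \<open>simp_all\<close>)
next
  case False
  then obtain A where A: "A \<in> R" "sc A" "\<not> deficient A" "\<forall>Z\<in>R. Z \<subset> A \<longrightarrow> \<not> sc Z"
    unfolding minimal_sc_def by blast
  obtain J where J: "J \<subseteq> E" "\<And>Z. Z \<in> R \<Longrightarrow> Z \<subset> A \<Longrightarrow> \<exists>e\<in>J. crosses e Z"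
    "card J + card {Q\<in>N. Q \<subseteq> Pow A} \<le> card {X\<in>leaves R. X \<subseteq> A}"
    by (rule cover[OF N_matching A(2)]) (use A(4) in \<open>simp_all\<close>)
  have "A \<in> R \<or> A = UNIV" "\<not> (A \<in> R \<and> deficient A)" using A by simp_all
  then show ?thesis by (rule that[OF _ A(2) _ J(1) _ J(3)]) (rule J(2))
qed

text \<open>A matched leaf does not contain its partner, and an unmatched one is left by a link.
  This ensures that every contraction makes the remaining family smaller.\<close>

lemma sc_not_leaf:
  assumes "A \<in> R" "sc A" shows "A \<notin> leaves R"
proof
  assume A: "A \<in> leaves R"
  show False
  proof (cases "A \<in> \<Union>N")
    case True
    then obtain Q where Q: "Q \<in> N" "A \<in> Q" by blast
    obtain X Z where XZ: "X \<in> leaves R" "Z \<in> leaves R" "Q = {X, Z}" "X \<noteq> Z"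
      by (rule matchingE[OF N_matching Q(1)]) blast
    have "X \<subseteq> A" "Z \<subseteq> A" using semiclosed_pair[OF assms(2) Q(1,2)] XZ(3) by blast+
    then have "X = A" "Z = A" using A XZ(1,2) leaves_R_subset unfolding leaves_def by blast+
    then show False using XZ(4) by simp
  next
    case False
    then have "closed_in E A A" by (rule semiclosed_single[OF assms(2) A]) simp
    then show False using crossed[OF R_family[OF assms(1)]] unfolding closed_in_def crosses_def by blast
  qed
qed

lemma progress:
  "(\<exists>J\<subseteq>E. (\<forall>S\<in>\<L>. \<exists>e\<in>J. crosses e S) \<and> real (card J) \<le> 7 / 4 * (\<Sum>e\<in>E. x e)) \<or>
   (\<exists>\<C>'. state \<C>' \<and> {S \<in> \<L>. \<forall>C\<in>\<C>'. \<not> S \<subset> C} \<subset> {S \<in> \<L>. \<forall>C\<in>\<C>. \<not> S \<subset> C})"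
proof -
  obtain A J where A: "A \<in> R \<or> A = UNIV" "sc A" "\<not> (A \<in> R \<and> deficient A)" and J: "J \<subseteq> E"
    "\<And>Z. Z \<in> R \<Longrightarrow> Z \<subset> A \<Longrightarrow> \<exists>e\<in>J. crosses e Z"
    "card J + card {Q\<in>N. Q \<subseteq> Pow A} \<le> card {X\<in>leaves R. X \<subseteq> A}"
    by (rule good_cover) blast
  let ?m = "card {Q\<in>Mc. Q \<subseteq> Pow A}" and ?p = "card {Q\<in>P. Q \<subseteq> Pow A}" and ?u = "card {X\<in>U. X \<subseteq> A}"
  have "card J + (?m + ?p) \<le> ?u + 2 * ?m"
    using J(3) card_leaves_below[OF A(2)] card_N_below[of A] by simp
  then have c: "real (card J) + real ?p \<le> real ?u + real ?m" by linarith
  note Ym = Y_ge_pairs[of A]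
  show ?thesis
  proof (cases "A \<in> R")
    case True
    let ?C = "insert A {C\<in>\<C>. \<not> C \<subseteq> A}"
    have "\<not> deficient A" using A(3) True by simp
    then have cA: "real (card J) + 1 \<le> real ?u + 3 / 4 * Y A" using c unfolding deficient_def by linarith
    have st: "state ?C" by (rule contract[OF True A(2) J(1) _ cA]) (rule J(2))
    obtain X where X: "X \<in> leaves R" "X \<subseteq> A" by (rule ex_leaf_below[OF finite_R True])
    then have "X \<subset> A" "X \<in> R" using sc_not_leaf[OF True A(2)] leaves_R_subset by blast+
    then have "X \<notin> {S \<in> \<L>. \<forall>C\<in>?C. \<not> S \<subset> C}" by blast
    moreover have "{S \<in> \<L>. \<forall>C\<in>?C. \<not> S \<subset> C} \<subseteq> R" unfolding R_def by blast
    ultimately have "{S \<in> \<L>. \<forall>C\<in>?C. \<not> S \<subset> C} \<subset> R" using \<open>X \<in> R\<close> by blast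
    then have "{S \<in> \<L>. \<forall>C\<in>?C. \<not> S \<subset> C} \<subset> {S \<in> \<L>. \<forall>C\<in>\<C>. \<not> S \<subset> C}" unfolding R_def .
    with st show ?thesis by (intro disjI2 exI[of _ ?C] conjI)
  next
    case False
    then have U: "A = UNIV" using A(1) by simp
    have "\<exists>e\<in>J. crosses e Z" if "Z \<in> R" for Z
      using J(2)[OF that] UNIV_notin R_family[OF that] U by blast
    \<comment> \<open>Nothing has to be left over here, so the bound 2 m \<le> Y suffices.\<close>
    moreover have "real (card J) \<le> real (card U) + 3 / 4 * Y UNIV"
      using c Ym U by simp
    ultimately show ?thesis by (intro disjI1 finish[OF J(1)])
  qed
qed

end

text \<open>The induction is on the size of the remaining family. \<open>M\<close> stays fixed,
  while \<open>P\<close> is chosen anew in each step because the units change.\<close>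

lemma (in matched_laminar_lp) matched_solution:
  "\<exists>J\<subseteq>E. (\<forall>S\<in>\<L>. \<exists>e\<in>J. crosses e S) \<and> real (card J) \<le> 7 / 4 * (\<Sum>e\<in>E. x e)"
proof -
  have "?thesis" if "state \<C>" for \<C>
    using that
  proof (induction "card {S \<in> \<L>. \<forall>C\<in>\<C>. \<not> S \<subset> C}" arbitrary: \<C> rule: less_induct)
    case less
    have "finite (\<C> \<union> free \<C>)"
    proof (rule finite_subset[OF _ finite_family])
      have "\<C> \<subseteq> \<L>" using less.prems unfolding state_def by (rule conjunct1)
      then show "\<C> \<union> free \<C> \<subseteq> \<L>" unfolding free_def using Unm_family by blast
    qed
    then obtain P where P: "matching (\<C> \<union> free \<C>) (linked E) P"
      "\<And>X Y. X \<in> \<C> \<union> free \<C> - \<Union>P \<Longrightarrow> Y \<in> \<C> \<union> free \<C> - \<Union>P \<Longrightarrow> X \<noteq> Y \<Longrightarrow> \<not> linked E X Y"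
      by (rule ex_maximal_matching[of _ "linked E"]) (use linked_commute in blast)+
    interpret contracted \<L> E x M \<C> P
      by unfold_locales (use less.prems P in auto)
    from progress show ?case
    proof
      assume "\<exists>\<C>'. state \<C>' \<and> {S \<in> \<L>. \<forall>C\<in>\<C>'. \<not> S \<subset> C} \<subset> {S \<in> \<L>. \<forall>C\<in>\<C>. \<not> S \<subset> C}"
      then obtain \<C>' where C': "state \<C>'" "{S \<in> \<L>. \<forall>C\<in>\<C>'. \<not> S \<subset> C} \<subset> {S \<in> \<L>. \<forall>C\<in>\<C>. \<not> S \<subset> C}"
        by (elim exE conjE)
      show ?thesis
        by (rule less.hyps[OF psubset_card_mono[OF _ C'(2)] C'(1)]) (use finite_family in simp)
    qed
  qed
  then show ?thesis using initial_state .
qed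

lemma (in laminar_lp) solution:
  "\<exists>J\<subseteq>E. (\<forall>S\<in>\<L>. \<exists>e\<in>J. crosses e S) \<and> real (card J) \<le> 7 / 4 * (\<Sum>e\<in>E. x e)"
proof -
  let ?rel = "\<lambda>X Y. linked E X Y \<and> \<not> twin X Y"
  show ?thesis
  proof (rule ex_maximal_matching[of "leaves \<L>" ?rel])
    show "finite (leaves \<L>)" using finite_family unfolding leaves_def by simp
    show "?rel Y X" if "?rel X Y" for X Y
      using that linked_commute[of E X Y] unfolding twin_def by blast
    fix M assume M: "matching (leaves \<L>) ?rel M"
      "\<And>X Y. X \<in> leaves \<L> - \<Union>M \<Longrightarrow> Y \<in> leaves \<L> - \<Union>M \<Longrightarrow> X \<noteq> Y \<Longrightarrow> \<not> ?rel X Y"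
    interpret matched_laminar_lp \<L> E x M
      by unfold_locales (use M in auto)
    show ?thesis by (rule matched_solution)
  qed
qed

theorem laminar_cover:
  fixes \<L> :: "'v set set" and E :: "('v \<times> 'v) set" and x :: "'v \<times> 'v \<Rightarrow> real"
  assumes "finite \<L>" "finite E" "laminar \<L>" "{} \<notin> \<L>"
    and nonneg: "\<And>e. e \<in> E \<Longrightarrow> 0 \<le> x e"
    and cut: "\<And>S. S \<in> \<L> \<Longrightarrow> 1 \<le> (\<Sum>e\<in>{e\<in>E. crosses e S}. x e)"
    and bunch: "\<And>A B C. A \<in> \<L> \<Longrightarrow> B \<in> \<L> \<Longrightarrow> C \<in> \<L> \<Longrightarrow> A \<inter> B = {} \<Longrightarrow> A \<subseteq> C \<Longrightarrow> B \<subseteq> C \<Longrightarrow>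
      2 \<le> (\<Sum>e\<in>{e\<in>E. crosses e A \<or> crosses e B \<or> crosses e C}. x e)"
  shows "\<exists>J\<subseteq>E. (\<forall>S\<in>\<L>. \<exists>e\<in>J. crosses e S) \<and> real (card J) \<le> 7 / 4 * (\<Sum>e\<in>E. x e)"
proof -
  \<comment> \<open>A link crossing no set of the family occurs in no constraint, and dropping it
    can only lower the objective.\<close>
  define E' where "E' = {e\<in>E. \<exists>S\<in>\<L>. crosses e S}"
  have E': "E' \<subseteq> E" "finite E'" using assms(2) unfolding E'_def by auto
  have restrict: "(\<Sum>e\<in>E'. x e * of_bool (p e)) = (\<Sum>e\<in>{e\<in>E. p e}. x e)"
    if "\<And>e. p e \<Longrightarrow> \<exists>S\<in>\<L>. crosses e S" for p
  proof -
    have "(\<Sum>e\<in>E'. x e * of_bool (p e)) = (\<Sum>e\<in>{e\<in>E'. p e}. x e)"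
      using E'(2) by (simp add: sum.inter_filter of_bool_def if_distrib cong: if_cong)
    moreover have "{e\<in>E'. p e} = {e\<in>E. p e}" using that unfolding E'_def by blast
    ultimately show ?thesis by simp
  qed
  interpret laminar_lp \<L> E' x
  proof
    show "1 \<le> (\<Sum>e\<in>E'. x e * of_bool (crosses e S))" if "S \<in> \<L>" for S
      by (subst restrict) (use cut[OF that] that in blast)+
    show "2 \<le> (\<Sum>e\<in>E'. x e * of_bool (crosses e A \<or> crosses e B \<or> crosses e C))"
      if "A \<in> \<L>" "B \<in> \<L>" "C \<in> \<L>" "A \<inter> B = {}" "A \<subseteq> C" "B \<subseteq> C" for A B C
      by (subst restrict) (use bunch[OF that] that(1-3) in blast)+
    show "\<exists>S\<in>\<L>. crosses e S" if "e \<in> E'" for e using that unfolding E'_def by simp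
  qed (use assms E' in auto)
  obtain J where J: "J \<subseteq> E'" "\<forall>S\<in>\<L>. \<exists>e\<in>J. crosses e S" "real (card J) \<le> 7 / 4 * (\<Sum>e\<in>E'. x e)"
    using solution by blast
  have "(\<Sum>e\<in>E'. x e) \<le> (\<Sum>e\<in>E. x e)"
    by (rule sum_mono2[OF assms(2) E'(1)]) (use assms(5) in simp)
  then show ?thesis using J E'(1) by (intro exI[of _ J]) auto
qed

section \<open>The laminar family of a rooted tree\<close>

lemma path_edges_simps [simp]:
  "path_edges [] = {}" "path_edges [u] = {}"
  "path_edges (u # v # p) = insert {u, v} (path_edges (v # p))"
proof -
  show "path_edges (u # v # p) = insert {u, v} (path_edges (v # p))"
  proof (intro subset_antisym subsetI)
    fix f assume "f \<in> path_edges (u # v # p)"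
    then obtain i where i: "f = {(u # v # p) ! i, (u # v # p) ! Suc i}" "Suc i < length (u # v # p)"
      unfolding path_edges_def by auto
    then show "f \<in> insert {u, v} (path_edges (v # p))"
      unfolding path_edges_def by (cases i) auto
  next
    fix f assume "f \<in> insert {u, v} (path_edges (v # p))"
    then consider "f = {u, v}" | i where "f = {(v # p) ! i, (v # p) ! Suc i}" "Suc i < length (v # p)"
      unfolding path_edges_def by auto
    then show "f \<in> path_edges (u # v # p)"
    proof cases
      case 1
      then show ?thesis unfolding path_edges_def by (auto intro!: exI[of _ 0])
    next
      case 2
      then show ?thesis unfolding path_edges_def by (auto intro!: exI[of _ "Suc i"])
    qed
  qed
qed (auto simp: path_edges_def)

lemma path_edges_append: "path_edges (p @ u # q) = path_edges (p @ [u]) \<union> path_edges (u # q)"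
proof (induction p)
  case (Cons a p)
  then show ?case by (cases p) auto
qed simp

lemma path_edges_subset_set: "f \<in> path_edges p \<Longrightarrow> f \<subseteq> set p"
  by (induction p rule: induct_list012) auto

lemma path_edge_split:
  assumes "f \<in> path_edges p"
  shows "\<exists>p1 u v p2. p = p1 @ u # v # p2 \<and> f = {u, v}"
  using assms
proof (induction p rule: induct_list012)
  case (3 u v p)
  show ?case
  proof (cases "f = {u, v}")
    case True
    then have "u # v # p = [] @ u # v # p \<and> f = {u, v}" by simp
    then show ?thesis by blast
  next
    case False
    then have "f \<in> path_edges (v # p)" using 3(3) by simp
    from 3(2)[OF this] obtain p1 u' v' p2 where "v # p = p1 @ u' # v' # p2" "f = {u', v'}" by blast
    then have "u # v # p = (u # p1) @ u' # v' # p2 \<and> f = {u', v'}" by simp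
    then show ?thesis by blast
  qed
qed auto

lemma sym_adj_rel: "sym (adj_rel V A en)"
  by (auto simp: sym_def adj_rel_def insert_commute)

lemma conn_sym: "(u, v) \<in> (adj_rel V A en)\<^sup>* \<Longrightarrow> (v, u) \<in> (adj_rel V A en)\<^sup>*"
  using sym_rtrancl[OF sym_adj_rel] by (metis symD)

lemma conn_mono: "A \<subseteq> B \<Longrightarrow> (u, v) \<in> (adj_rel V A en)\<^sup>* \<Longrightarrow> (u, v) \<in> (adj_rel V B en)\<^sup>*"
  by (erule rtrancl_mono[THEN subsetD, rotated]) (auto simp: adj_rel_def)

lemma conn_in: "(u, v) \<in> (adj_rel V A en)\<^sup>* \<Longrightarrow> u \<in> V \<Longrightarrow> v \<in> V"
  by (induction rule: rtrancl_induct) (auto simp: adj_rel_def)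

lemma path_conn:
  "set p \<subseteq> V \<Longrightarrow> path_edges p \<subseteq> F \<Longrightarrow> p \<noteq> [] \<Longrightarrow> (hd p, last p) \<in> (adj_rel V F id)\<^sup>*"
proof (induction p rule: induct_list012)
  case (3 u v p)
  then have "(u, v) \<in> adj_rel V F id" unfolding adj_rel_def by auto
  moreover have "set (v # p) \<subseteq> V" "path_edges (v # p) \<subseteq> F" using 3(3,4) by auto
  then have "(hd (v # p), last (v # p)) \<in> (adj_rel V F id)\<^sup>*" by (rule 3(2)) (rule list.distinct(2))
  then have "(v, last (u # v # p)) \<in> (adj_rel V F id)\<^sup>*" by (simp only: list.sel last.simps list.distinct if_False)
  ultimately show ?case unfolding list.sel by (rule converse_rtrancl_into_rtrancl)
qed auto

lemma conn_path:
  assumes "(u, v) \<in> (adj_rel V F id)\<^sup>*" "u \<in> V"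
  shows "\<exists>p. is_path V F p \<and> hd p = u \<and> last p = v"
  using assms(1)
proof (induction rule: rtrancl_induct)
  case base
  show ?case using assms(2) by (intro exI[of _ "[u]"]) (auto simp: is_path_def)
next
  case (step y z)
  then obtain p where p: "p \<noteq> []" "distinct p" "set p \<subseteq> V" "path_edges p \<subseteq> F" "hd p = u" "last p = y"
    unfolding is_path_def by blast
  have z: "z \<in> V" "{y, z} \<in> F" using step(2) unfolding adj_rel_def by auto
  show ?case
  proof (cases "z \<in> set p")
    case True
    then obtain q q' where q: "p = q @ z # q'" by (meson split_list)
    then have "path_edges (q @ [z]) \<subseteq> F" using p(4) path_edges_append[of q z q'] by simp
    moreover have "hd (q @ [z]) = u" using p(5) q by (cases q) auto
    ultimately show ?thesis using p(2,3) q by (intro exI[of _ "q @ [z]"]) (auto simp: is_path_def)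
  next
    case False
    have "p = butlast p @ [y]" using p(1,6) append_butlast_last_id by metis
    then have "path_edges (p @ [z]) = path_edges p \<union> {{y, z}}"
      using path_edges_append[of "butlast p" y "[z]"] by (metis append.assoc append_Cons append_Nil path_edges_simps(2,3))
    then have "path_edges (p @ [z]) \<subseteq> F" using p(4) z(2) by simp
    then show ?thesis using p False z(1) by (intro exI[of _ "p @ [z]"]) (auto simp: is_path_def)
  qed
qed

lemma conn_avoid:
  assumes "(u, v) \<in> (adj_rel V G id)\<^sup>*" "\<And>w. (u, w) \<in> (adj_rel V G id)\<^sup>* \<Longrightarrow> w \<notin> g"
  shows "(u, v) \<in> (adj_rel V (G - {g}) id)\<^sup>*"
  using assms(1)
proof (induction rule: rtrancl_induct)
  case (step y z)
  have "y \<notin> g" by (rule assms(2)[OF step(1)])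
  then have "(y, z) \<in> adj_rel V (G - {g}) id" using step(2) unfolding adj_rel_def by auto
  then show ?case using step(3) by (rule rtrancl_into_rtrancl[rotated])
qed simp

lemma conn_join:
  "(w, u) \<in> (adj_rel V A en)\<^sup>* \<Longrightarrow> (w, v) \<in> (adj_rel V A en)\<^sup>* \<Longrightarrow> (u, v) \<in> (adj_rel V A en)\<^sup>*"
  by (rule rtrancl_trans[OF conn_sym])

lemma conn_meet:
  "(u, w) \<in> (adj_rel V A en)\<^sup>* \<Longrightarrow> (v, w) \<in> (adj_rel V A en)\<^sup>* \<Longrightarrow> (u, v) \<in> (adj_rel V A en)\<^sup>*"
  by (rule rtrancl_trans[OF _ conn_sym])

section \<open>Tree edges as vertex sets\<close>

locale rooted_tree =
  fixes V :: "'v set" and F :: "'v set set" and r :: 'v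
  assumes tree: "is_tree V F" and root: "r \<in> V"
begin

abbreviation "conn G \<equiv> (adj_rel V G id)\<^sup>*"

text \<open>For a tree edge \<open>f\<close> this is the vertex set of the subtree hanging below
  \<open>f\<close>.\<close>

definition side :: "'v set \<Rightarrow> 'v set" where
  "side f = {u \<in> V. (r, u) \<notin> conn (F - {f})}"

lemma finite_V: "finite V"
  using tree unfolding is_tree_def by simp

lemma edgeE:
  assumes "f \<in> F"
  obtains u v where "f = {u, v}" "u \<noteq> v" "u \<in> V" "v \<in> V"
proof -
  have "f \<subseteq> V" "card f = 2" using tree assms unfolding is_tree_def by auto
  then obtain u v where "f = {u, v}" "u \<noteq> v" by (meson card_2_iff)
  then show ?thesis using that \<open>f \<subseteq> V\<close> by auto
qed

lemma finite_F: "finite F"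
proof (rule finite_subset)
  show "F \<subseteq> Pow V" using tree unfolding is_tree_def by blast
qed (use finite_V in simp)

lemma connected: "u \<in> V \<Longrightarrow> v \<in> V \<Longrightarrow> (u, v) \<in> conn F"
  using tree unfolding is_tree_def graph_connected_def by simp

text \<open>A path from \<open>u\<close> to \<open>v\<close> that avoids the edge has a third
  vertex, so the edge would close it to a cycle.\<close>

lemma edge_separates:
  assumes "{u, v} \<in> F" "u \<noteq> v" "u \<in> V"
  shows "(u, v) \<notin> conn (F - {{u, v}})"
proof
  assume "(u, v) \<in> conn (F - {{u, v}})"
  from conn_path[OF this assms(3)] obtain p where
    p: "is_path V (F - {{u, v}}) p" "hd p = u" "last p = v" by blast
  have "3 \<le> length p"
  proof (rule ccontr)
    assume "\<not> 3 \<le> length p"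
    moreover have "p \<noteq> []" using p(1) unfolding is_path_def by simp
    ultimately obtain a b where "p = [a] \<or> p = [a, b]"
      by (cases p rule: remdups_adj.cases; cases "tl (tl p)") auto
    then show False using p assms(2) unfolding is_path_def by auto
  qed
  moreover have "is_path V F p" using p(1) unfolding is_path_def by auto
  moreover have "{last p, hd p} \<in> F" using p assms(1) by (simp add: insert_commute)
  ultimately have "has_cycle V F" unfolding has_cycle_def by blast
  then show False using tree unfolding is_tree_def by simp
qed

lemma two_components:
  assumes "{u, v} \<in> F" "u \<in> V" "w \<in> V"
  shows "(w, u) \<in> conn (F - {{u, v}}) \<or> (w, v) \<in> conn (F - {{u, v}})"
proof -
  have "(u, w) \<in> conn (F - {{u, v}}) \<or> (v, w) \<in> conn (F - {{u, v}})"
    using connected[OF assms(2,3)]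
  proof (induction rule: rtrancl_induct)
    case (step y z)
    show ?case
    proof (cases "{y, z} = {u, v}")
      case True
      then show ?thesis by (auto simp: doubleton_eq_iff)
    next
      case False
      then have "(y, z) \<in> adj_rel V (F - {{u, v}}) id" using step(2) unfolding adj_rel_def by auto
      then show ?thesis using step(3) by (meson rtrancl_into_rtrancl)
    qed
  qed simp
  then show ?thesis
    using conn_sym[of u w V "F - {{u, v}}" id] conn_sym[of v w V "F - {{u, v}}" id] by argo
qed

text \<open>Deleting \<open>f\<close> leaves at most two components, so two vertices not connected
  to the root are connected to each other.\<close>

lemma side_eq_iff:
  assumes "f \<in> F" "u \<in> V" "v \<in> V"
  shows "(u \<in> side f \<longleftrightarrow> v \<in> side f) \<longleftrightarrow> (u, v) \<in> conn (F - {f})"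
proof
  assume "(u, v) \<in> conn (F - {f})"
  then have "(r, u) \<in> conn (F - {f}) \<longleftrightarrow> (r, v) \<in> conn (F - {f})"
    by (meson conn_meet rtrancl_trans)
  then show "u \<in> side f \<longleftrightarrow> v \<in> side f" using assms unfolding side_def by simp
next
  assume eq: "u \<in> side f \<longleftrightarrow> v \<in> side f"
  obtain a b where f: "f = {a, b}" "a \<in> V" using edgeE[OF assms(1)] by metis
  have comp: "(w, a) \<in> conn (F - {f}) \<or> (w, b) \<in> conn (F - {f})" if "w \<in> V" for w
    using two_components[of a b w] assms(1) f that by simp
  show "(u, v) \<in> conn (F - {f})"
  proof (cases "u \<in> side f")
    case True
    then have "(r, u) \<notin> conn (F - {f})" "(r, v) \<notin> conn (F - {f})" using eq unfolding side_def by auto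
    then show ?thesis
      using comp[OF root] comp[OF assms(2)] comp[OF assms(3)] by (meson conn_meet)
  next
    case False
    then have "(r, u) \<in> conn (F - {f})" "(r, v) \<in> conn (F - {f})" using eq assms unfolding side_def by auto
    then show ?thesis by (rule conn_join)
  qed
qed

lemma side_crossed_iff:
  assumes "f \<in> F" "u \<in> V" "v \<in> V"
  shows "crosses (u, v) (side f) \<longleftrightarrow> (u, v) \<notin> conn (F - {f})"
  using side_eq_iff[OF assms] unfolding crosses_def by auto

text \<open>A path through \<open>f\<close> splits into two pieces avoiding \<open>f\<close> that
  end on different sides of it. Conversely, a path avoiding \<open>f\<close> would connect
  \<open>u\<close> and \<open>v\<close> in the tree without \<open>f\<close>.\<close>

lemma covers_iff_crosses:
  assumes "f \<in> F" "u \<in> V" "v \<in> V"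
  shows "covers V F (u, v) f \<longleftrightarrow> crosses (u, v) (side f)"
  unfolding side_crossed_iff[OF assms]
proof
  assume "covers V F (u, v) f"
  then obtain p where p: "is_path V F p" "hd p = u" "last p = v" "f \<in> path_edges p"
    unfolding covers_def by auto
  from path_edge_split[OF p(4)] obtain p1 a b p2 where s: "p = p1 @ a # b # p2" "f = {a, b}" by blast
  have d: "distinct p" "set p \<subseteq> V" "path_edges p \<subseteq> F" using p(1) unfolding is_path_def by auto
  have "b \<notin> set (p1 @ [a])" "a \<notin> set (b # p2)" using d(1) s(1) by auto
  then have "f \<notin> path_edges (p1 @ [a])" "f \<notin> path_edges (b # p2)"
    using path_edges_subset_set[of f] s(2) by blast+
  then have e: "path_edges (p1 @ [a]) \<subseteq> F - {f}" "path_edges (b # p2) \<subseteq> F - {f}"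
    using d(3) s path_edges_append[of p1 a "b # p2"] by auto
  have "hd (p1 @ [a]) = u" using p(2) s(1) by (cases p1) auto
  then have ua: "(u, a) \<in> conn (F - {f})" using path_conn[of "p1 @ [a]" V "F - {f}"] d(2) s(1) e(1) by simp
  have bv: "(b, v) \<in> conn (F - {f})" using path_conn[of "b # p2" V "F - {f}"] d(2) s(1) e(2) p(3) by simp
  have "(a, b) \<notin> conn (F - {f})"
    using edge_separates[of a b] assms(1) s d(1,2) by auto
  then show "(u, v) \<notin> conn (F - {f})"
    using conn_meet[OF conn_join[OF ua] bv] by blast
next
  assume n: "(u, v) \<notin> conn (F - {f})"
  from conn_path[OF connected[OF assms(2,3)] assms(2)] obtain p where
    p: "is_path V F p" "hd p = u" "last p = v" by blast
  have "f \<in> path_edges p"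
  proof (rule ccontr)
    assume "f \<notin> path_edges p"
    then have "(hd p, last p) \<in> conn (F - {f})"
      using path_conn[of p V "F - {f}"] p(1) unfolding is_path_def by auto
    then show False using n p by simp
  qed
  then show "covers V F (u, v) f" unfolding covers_def using p by auto
qed

lemma root_notin_side: "r \<notin> side f"
  unfolding side_def by simp

lemma side_subset: "side f \<subseteq> V"
  unfolding side_def by blast

lemma edge_crosses_side:
  assumes "f \<in> F" "g \<in> F" "g = {c, d}" "c \<noteq> d" "c \<in> V" "d \<in> V"
  shows "(c \<in> side f) \<noteq> (d \<in> side f) \<longleftrightarrow> f = g"
proof (cases "f = g")
  case True
  then show ?thesis using side_eq_iff[OF assms(1,5,6)] edge_separates[of c d] assms by simp
next
  case False
  then have "(c, d) \<in> adj_rel V (F - {f}) id" using assms unfolding adj_rel_def by auto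
  then show ?thesis using side_eq_iff[OF assms(1,5,6)] False by auto
qed

lemma side_nonempty: "f \<in> F \<Longrightarrow> side f \<noteq> {}"
  using edge_crosses_side by (metis edgeE empty_iff)

text \<open>Both ends of an edge \<open>g\<close> other than \<open>f\<close> are on the same side
  of \<open>f\<close>. If they are in \<open>side f\<close>, every vertex outside is joined to the
  root without \<open>g\<close>, so \<open>side g\<close> is contained in \<open>side f\<close>.
  Otherwise \<open>side f\<close> stays connected without \<open>g\<close> and lies on one side of
  it.\<close>

lemma sides_laminar: "laminar (side ` F)"
proof -
  have "side f \<subseteq> side g \<or> side g \<subseteq> side f \<or> side f \<inter> side g = {}"
    if f: "f \<in> F" and g: "g \<in> F" and ne: "f \<noteq> g" for f g
  proof -
    obtain c d where cd: "g = {c, d}" "c \<noteq> d" "c \<in> V" "d \<in> V" by (rule edgeE[OF g])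
    have same: "c \<in> side f \<longleftrightarrow> d \<in> side f" using edge_crosses_side[OF f g cd] ne by simp
    show ?thesis
    proof (cases "c \<in> side f")
      case True
      have "u \<notin> side g" if u: "u \<in> V" "u \<notin> side f" for u
      proof -
        have ru: "(r, u) \<in> conn (F - {f})" using u unfolding side_def by simp
        have "(r, u) \<in> conn (F - {f} - {g})"
        proof (rule conn_avoid[OF ru])
          fix w assume "(r, w) \<in> conn (F - {f})"
          then have "w \<notin> side f" unfolding side_def by simp
          then show "w \<notin> g" using True same cd(1) by auto
        qed
        then have "(r, u) \<in> conn (F - {g})" by (rule conn_mono[rotated]) blast
        then show ?thesis unfolding side_def by simp
      qed
      then show ?thesis using side_subset by blast
    next
      case False
      have "u \<in> side g \<longleftrightarrow> v \<in> side g" if uv: "u \<in> side f" "v \<in> side f" for u v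
      proof -
        have V: "u \<in> V" "v \<in> V" using uv side_subset by auto
        then have c: "(u, v) \<in> conn (F - {f})" using side_eq_iff[OF f V] uv by simp
        have "(u, v) \<in> conn (F - {f} - {g})"
        proof (rule conn_avoid[OF c])
          fix w assume w: "(u, w) \<in> conn (F - {f})"
          then have "w \<in> side f" using side_eq_iff[OF f V(1) conn_in[OF w V(1)]] uv(1) by simp
          then show "w \<notin> g" using False same cd(1) by auto
        qed
        then have "(u, v) \<in> conn (F - {g})" by (rule conn_mono[rotated]) blast
        then show ?thesis using side_eq_iff[OF g V] by simp
      qed
      then show ?thesis by blast
    qed
  qed
  then show ?thesis unfolding laminar_def by blast
qed

section \<open>Bunches and augmentations in terms of sides\<close>

lemma bunch_single: "f \<in> F \<Longrightarrow> bunch V F {f}"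
  by (auto simp: bunch_def Int_insert_left)

text \<open>The ends of a path through all three edges would be separated by each side. One end is
  then in \<open>side f1\<close> and the other in \<open>side f2\<close>, so both are in
  \<open>side f3\<close>.\<close>

lemma bunch_triple:
  assumes F: "f1 \<in> F" "f2 \<in> F" "f3 \<in> F"
    and s: "side f1 \<inter> side f2 = {}" "side f1 \<subseteq> side f3" "side f2 \<subseteq> side f3"
  shows "bunch V F {f1, f2, f3}" "card {f1, f2, f3} = 3"
proof -
  have ne: "side f1 \<noteq> {}" "side f2 \<noteq> {}" using side_nonempty F by auto
  then have "f1 \<noteq> f2" "f1 \<noteq> f3" "f2 \<noteq> f3" using s by auto
  then show c: "card {f1, f2, f3} = 3" by simp
  have "\<not> 3 \<le> card ({f1, f2, f3} \<inter> path_edges p)" if p: "is_path V F p" for p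
  proof
    assume "3 \<le> card ({f1, f2, f3} \<inter> path_edges p)"
    then have "{f1, f2, f3} \<inter> path_edges p = {f1, f2, f3}"
      by (intro card_seteq) (use c in simp_all)
    then have on: "f1 \<in> path_edges p" "f2 \<in> path_edges p" "f3 \<in> path_edges p" by auto
    have V: "hd p \<in> V" "last p \<in> V" using p unfolding is_path_def by auto
    have "crosses (hd p, last p) (side f)" if "f \<in> F" "f \<in> path_edges p" for f
      using covers_iff_crosses[OF that(1) V] p that(2) unfolding covers_def by auto
    then have "crosses (hd p, last p) (side f1)" "crosses (hd p, last p) (side f2)" "crosses (hd p, last p) (side f3)"
      using F on by auto
    then show False using s unfolding crosses_def by auto
  qed
  then show "bunch V F {f1, f2, f3}" unfolding bunch_def using F c by auto
qed

lemma psi_eq: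
  assumes "E \<subseteq> V \<times> V" "B \<subseteq> F"
  shows "psi V F E B = {e \<in> E. \<exists>f\<in>B. crosses e (side f)}"
proof -
  have "covers V F e f \<longleftrightarrow> crosses e (side f)" if "e \<in> E" "f \<in> B" for e f
  proof -
    have "f \<in> F" "fst e \<in> V" "snd e \<in> V" using assms that by auto
    from covers_iff_crosses[OF this] show ?thesis by simp
  qed
  then show ?thesis unfolding psi_def by blast
qed

lemma adj_tree: "Inl ` G \<subseteq> A \<Longrightarrow> adj_rel V G id \<subseteq> adj_rel V A aug_ends"
  unfolding adj_rel_def aug_ends_def by force

text \<open>Deleting a link leaves the whole tree. Deleting \<open>f\<close> leaves
  \<open>side f\<close> and its complement, each still connected, and a link crossing
  \<open>side f\<close> joins them.\<close>

lemma augmentation_if_crosses: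
  assumes E: "E \<subseteq> V \<times> V" "J \<subseteq> E" and c: "\<And>f. f \<in> F \<Longrightarrow> \<exists>e\<in>J. crosses e (side f)"
  shows "J \<in> augmentations V F E"
proof -
  have tree_conn: "(u, v) \<in> (adj_rel V A aug_ends)\<^sup>*" if "Inl ` G \<subseteq> A" "(u, v) \<in> conn G" for u v G A
    using rtrancl_mono[OF adj_tree[OF that(1)]] that(2) by blast
  have all: "graph_connected V A aug_ends" if "Inl ` F \<subseteq> A" for A
    unfolding graph_connected_def using root tree_conn[OF that] connected by blast
  have "graph_connected V ((F <+> J) - {e}) aug_ends" if e: "e \<in> F <+> J" for e
  proof (cases e)
    case (Inr j)
    then show ?thesis by (intro all) auto
  next
    case (Inl f)
    let ?A = "(F <+> J) - {e}"
    have f: "f \<in> F" using e Inl by auto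
    have sub: "Inl ` (F - {f}) \<subseteq> ?A" using Inl by auto
    obtain u v where j: "(u, v) \<in> J" "crosses (u, v) (side f)" using c[OF f] by auto
    have uv: "u \<in> V" "v \<in> V" using j(1) E by auto
    have adj: "(u, v) \<in> adj_rel V ?A aug_ends" "(v, u) \<in> adj_rel V ?A aug_ends"
      using j(1) uv Inl unfolding adj_rel_def aug_ends_def by (auto intro!: bexI[of _ "Inr (u, v)"])
    obtain a b where ab: "(a, b) \<in> adj_rel V ?A aug_ends" "a \<in> V" "b \<in> V" "a \<notin> side f" "b \<in> side f"
      using adj uv j(2) unfolding crosses_def by (metis fst_conv snd_conv)
    have "(r, w) \<in> (adj_rel V ?A aug_ends)\<^sup>*" if w: "w \<in> V" for w
    proof (cases "w \<in> side f")
      case False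
      then have "(r, w) \<in> conn (F - {f})" using w unfolding side_def by simp
      then show ?thesis by (rule tree_conn[OF sub])
    next
      case True
      have "(r, a) \<in> conn (F - {f})" using ab unfolding side_def by simp
      then have "(r, a) \<in> (adj_rel V ?A aug_ends)\<^sup>*" by (rule tree_conn[OF sub])
      moreover have "(b, w) \<in> conn (F - {f})" using side_eq_iff[OF f ab(3) w] True ab(5) by simp
      then have "(b, w) \<in> (adj_rel V ?A aug_ends)\<^sup>*" by (rule tree_conn[OF sub])
      ultimately show ?thesis using ab(1) by (meson rtrancl_into_rtrancl rtrancl_trans)
    qed
    then show ?thesis unfolding graph_connected_def using root by (auto intro: conn_join)
  qed
  moreover have "graph_connected V (F <+> J) aug_ends" by (rule all) auto
  ultimately show ?thesis unfolding augmentations_def two_edge_connected_def using E(2) by simp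
qed

text \<open>Without such a link, deleting \<open>f\<close> would cut \<open>side f\<close> off from
  the root. The theorem uses this to see that the LP has a feasible solution.\<close>

lemma crosses_if_augmentation:
  assumes J: "J \<in> augmentations V F E" and f: "f \<in> F"
  shows "\<exists>e\<in>J. crosses e (side f)"
proof (rule ccontr)
  assume n: "\<not> ?thesis"
  let ?A = "(F <+> J) - {Inl f}"
  have conn: "graph_connected V ?A aug_ends"
    using J f unfolding augmentations_def two_edge_connected_def by auto
  have step: "y \<in> side f \<longleftrightarrow> z \<in> side f" if yz: "(y, z) \<in> adj_rel V ?A aug_ends" for y z
  proof -
    obtain e where e: "e \<in> ?A" "aug_ends e = {y, z}" and V: "y \<in> V" "z \<in> V"
      using yz unfolding adj_rel_def by auto
    show ?thesis
    proof (cases e)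
      case (Inl g)
      then have "(y, z) \<in> adj_rel V (F - {f}) id"
        using e V unfolding adj_rel_def aug_ends_def by auto
      then show ?thesis using side_eq_iff[OF f V] by blast
    next
      case (Inr j)
      then have "j \<in> J" "{fst j, snd j} = {y, z}" using e unfolding aug_ends_def by (auto split: prod.splits)
      then show ?thesis using n unfolding crosses_def by (auto simp: doubleton_eq_iff)
    qed
  qed
  have "w \<notin> side f" if "(r, w) \<in> (adj_rel V ?A aug_ends)\<^sup>*" for w
    using that by (induction rule: rtrancl_induct) (use step root_notin_side in auto)
  then have "side f = {}" using conn root side_subset unfolding graph_connected_def by blast
  then show False using side_nonempty[OF f] by simp
qed

end

theorem theorem3:
  fixes V :: "'v set" and F :: "'v set set" and E :: "('v \<times> 'v) set"
  assumes "is_tree V F"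
    and "E \<subseteq> V \<times> V"
    and "augmentations V F E \<noteq> {}"
  shows "real (tap_opt V F E) \<le> 7 / 4 * bunch3_lp_value V F E"
proof -
  obtain r where "r \<in> V" using assms(1) unfolding is_tree_def graph_connected_def by blast
  then interpret rooted_tree V F r using assms(1) by unfold_locales
  have finE: "finite E" using finite_subset[OF assms(2)] finite_V by simp
  have fin_aug: "finite (card ` augmentations V F E)"
    by (rule finite_imageI, rule finite_subset[of _ "Pow E"]) (use finE in \<open>auto simp: augmentations_def\<close>)
  \<comment> \<open>In this scaling it is a lower bound on every feasible value, hence on the
    infimum.\<close>
  have bound: "4 / 7 * real (tap_opt V F E) \<le> (\<Sum>e\<in>E. x e)" if x: "bunch3_lp_feasible V F E x" for x
  proof -
    have con: "bunch_weight B \<le> (\<Sum>e\<in>{e\<in>E. \<exists>f\<in>B. crosses e (side f)}. x e)"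
      if "bunch V F B" "card B \<le> 3" for B
    proof -
      have "B \<subseteq> F" using that(1) unfolding bunch_def by simp
      then show ?thesis using x that unfolding bunch3_lp_feasible_def psi_eq[OF assms(2) \<open>B \<subseteq> F\<close>, symmetric] by simp
    qed
    have "\<exists>J\<subseteq>E. (\<forall>S\<in>side ` F. \<exists>e\<in>J. crosses e S) \<and> real (card J) \<le> 7 / 4 * (\<Sum>e\<in>E. x e)"
    proof (rule laminar_cover[OF _ finE sides_laminar])
      show "finite (side ` F)" using finite_F by simp
      show "{} \<notin> side ` F" using side_nonempty by force
      show "0 \<le> x e" if "e \<in> E" for e using x that unfolding bunch3_lp_feasible_def by simp
      show "1 \<le> (\<Sum>e\<in>{e\<in>E. crosses e S}. x e)" if S: "S \<in> side ` F" for S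
      proof -
        obtain f where "f \<in> F" "S = side f" using S by blast
        then show ?thesis using con[OF bunch_single] unfolding bunch_weight_def by simp
      qed
      show "2 \<le> (\<Sum>e\<in>{e\<in>E. crosses e A \<or> crosses e B \<or> crosses e C}. x e)"
        if ABC: "A \<in> side ` F" "B \<in> side ` F" "C \<in> side ` F" "A \<inter> B = {}" "A \<subseteq> C" "B \<subseteq> C" for A B C
      proof -
        obtain f1 f2 f3 where f: "f1 \<in> F" "f2 \<in> F" "f3 \<in> F" "A = side f1" "B = side f2" "C = side f3"
          using ABC(1-3) by blast
        note b = bunch_triple[OF f(1-3)]
        have "bunch V F {f1, f2, f3}" "card {f1, f2, f3} = 3" using b ABC(4-6) f(4-6) by auto
        then show ?thesis using con[of "{f1, f2, f3}"] f(4-6) unfolding bunch_weight_def by simp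
      qed
    qed
    then obtain J where J: "J \<subseteq> E" "\<forall>S\<in>side ` F. \<exists>e\<in>J. crosses e S" "real (card J) \<le> 7 / 4 * (\<Sum>e\<in>E. x e)"
      by blast
    have "J \<in> augmentations V F E" by (rule augmentation_if_crosses[OF assms(2) J(1)]) (use J(2) in simp)
    then have "tap_opt V F E \<le> card J" unfolding tap_opt_def using fin_aug by (intro Min_le) auto
    then show ?thesis using J(3) by linarith
  qed
  \<comment> \<open>so that the infimum is not taken over the empty set\<close>
  have "bunch3_lp_feasible V F E (\<lambda>_. 2)"
    unfolding bunch3_lp_feasible_def
  proof (intro conjI allI impI ballI)
    fix B assume B: "bunch V F B \<and> card B \<le> 3"
    then have "odd (card B)" and BF: "B \<subseteq> F" unfolding bunch_def by auto
    then obtain f where f: "f \<in> B" by fastforce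
    obtain J where J: "J \<in> augmentations V F E" using assms(3) by blast
    then obtain e where "e \<in> E" "crosses e (side f)"
      using crosses_if_augmentation[OF J, of f] f BF unfolding augmentations_def by blast
    then have "psi V F E B \<noteq> {}" unfolding psi_eq[OF assms(2) BF] using f by blast
    moreover have "finite (psi V F E B)" using finE unfolding psi_def by simp
    ultimately have "1 \<le> card (psi V F E B)" by (simp add: Suc_leI card_gt_0_iff)
    \<comment> \<open>The constant 2 is the largest weight of a bunch with at most three edges, so a
      single covering link suffices.\<close>
    then show "bunch_weight B \<le> (\<Sum>e\<in>psi V F E B. 2)" using B unfolding bunch_weight_def by simp
  qed simp
  then have "4 / 7 * real (tap_opt V F E) \<le> bunch3_lp_value V F E"
    unfolding bunch3_lp_value_def by (intro cInf_greatest) (use bound in auto)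
  then show ?thesis by simp
qed

end
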